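(* There is a bijection between the set of isomorphism classes of finite-dimensional irreducible $\mathcal{O}$-modules of type $(0,0)$ and the set of isomorphism classes of finite-dimensional irreducible $\boxtimes$-modules, under which the isomorphism class of a $\boxtimes$-module $V$ corresponds to the isomorphism class of the $\mathcal{O}$-module with the same underlying vector space $V$ on which the standard generators $X,Y$ of $\mathcal{O}$ act as $X_{01},X_{23}$ respectively.
   Context: $\mathbb{K}$ is an algebraically closed field of characteristic $0$. All Lie algebras and modules are over $\mathbb{K}$; irreducible modules are nonzero. Tetrahedron algebra: let $\mathbb{I}=\{0,1,2,3\}$. $\boxtimes$ is the Lie algebra over $\mathbb{K}$ with generators $\{X_{rs} \mid r,s\in\mathbb{I}, r\neq s\}$ and relations: (i) for distinct $r,s\in\mathbb{I}$, $X_{rs}+X_{sr}=0$; (ii) for mutually distinct $r,s,t\in\mathbb{I}$, $[X_{rs},X_{st}]=2X_{rs}+2X_{st}$; (iii) for mutually distinct $r,s,t,u\in\mathbb{I}$, $[X_{rs},[X_{rs},[X_{rs},X_{tu}]]]=4[X_{rs},X_{tu}]$. Onsager algebra: $\mathcal{O}$ is the Lie algebra over $\mathbb{K}$ with generators $X,Y$ (the standard generators) and relations $[X,[X,[X,Y]]]=4[X,Y]$ and $[Y,[Y,[Y,X]]]=4[Y,X]$. Type: for every finite-dimensional irreducible $\mathcal{O}$-module $V$, $X$ and $Y$ are diagonalizable on $V$ and there exist an integer $d\geq 0$ and scalars $\alpha,\alpha^*\in\mathbb{K}$ such that the set of distinct eigenvalues of $X$ (resp. $Y$) on $V$ is $\{d-2i+\alpha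 \mid 0\leq i\leq d\}$ (resp. $\{d-2i+\alpha^* \mid 0\leq i\leq d\}$). The ordered pair $(\alpha,\alpha^* )$ is called the type of $V$, and $d$ its diameter. *)

theory Defs
  imports "HOL-Computational_Algebra.Computational_Algebra"
begin

section \<open>Lie algebras and their modules\<close>

locale lie_algebra = vector_space scale
  for scale :: "'k::field \<Rightarrow> 'l::ab_group_add \<Rightarrow> 'l" (infixr \<open>*s\<close> 75) +
  fixes bracket :: "'l \<Rightarrow> 'l \<Rightarrow> 'l"
  assumes bracket_add_left: "bracket (x + y) z = bracket x z + bracket y z"
    and bracket_add_right: "bracket z (x + y) = bracket z x + bracket z y"
    and bracket_scale_left: "bracket (a *s x) y = a *s bracket x y"
    and bracket_scale_right: "bracket x (a *s y) = a *s bracket x y"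
    and bracket_self: "bracket x x = 0"
    and jacobi: "bracket x (bracket y z) + bracket y (bracket z x) + bracket z (bracket x y) = 0"

text \<open>
  The underlying space of a module is a subspace \<open>carrier V\<close> of an ambient vector space
  \<open>'v\<close>; the values of \<open>act V\<close> outside \<open>carrier V\<close> carry no meaning. This makes it possible to
  speak of the set of all modules whose underlying space lies in \<open>'v\<close>. If \<open>'v\<close> is
  infinite-dimensional, then every finite-dimensional module is isomorphic to one of these.
\<close>

record ('l, 'v) lie_mod =
  carrier :: "'v set"
  act :: "'l \<Rightarrow> 'v \<Rightarrow> 'v"

definition lie_module ::
  "('k::field \<Rightarrow> 'l::ab_group_add \<Rightarrow> 'l) \<Rightarrow> ('l \<Rightarrow> 'l \<Rightarrow> 'l) \<Rightarrow>
   ('k \<Rightarrow> 'v::ab_group_add \<Rightarrow> 'v) \<Rightarrow> ('l, 'v) lie_mod \<Rightarrow> bool" where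
  "lie_module scaleL br scale V \<longleftrightarrow>
     module.subspace scale (carrier V) \<and>
     (\<forall>x. \<forall>v\<in>carrier V. act V x v \<in> carrier V) \<and>
     (\<forall>x. \<forall>v\<in>carrier V. \<forall>w\<in>carrier V. act V x (v + w) = act V x v + act V x w) \<and>
     (\<forall>x c. \<forall>v\<in>carrier V. act V x (scale c v) = scale c (act V x v)) \<and>
     (\<forall>x y. \<forall>v\<in>carrier V. act V (x + y) v = act V x v + act V y v) \<and>
     (\<forall>x c. \<forall>v\<in>carrier V. act V (scaleL c x) v = scale c (act V x v)) \<and>
     (\<forall>x y. \<forall>v\<in>carrier V. act V (br x y) v = act V x (act V y v) - act V y (act V x v))"

definition finite_dim :: "('k::field \<Rightarrow> 'v::ab_group_add \<Rightarrow> 'v) \<Rightarrow> ('l, 'v) lie_mod \<Rightarrow> bool" where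
  "finite_dim scale V \<longleftrightarrow> (\<exists>B. finite B \<and> module.span scale B = carrier V)"

definition irreducible_mod :: "('k::field \<Rightarrow> 'v::ab_group_add \<Rightarrow> 'v) \<Rightarrow> ('l, 'v) lie_mod \<Rightarrow> bool" where
  "irreducible_mod scale V \<longleftrightarrow>
     carrier V \<noteq> {0} \<and>
     (\<forall>W. module.subspace scale W \<and> W \<subseteq> carrier V \<and> (\<forall>x. \<forall>w\<in>W. act V x w \<in> W)
        \<longrightarrow> W = {0} \<or> W = carrier V)"

definition fd_irreducible_modules ::
  "('k::field \<Rightarrow> 'l::ab_group_add \<Rightarrow> 'l) \<Rightarrow> ('l \<Rightarrow> 'l \<Rightarrow> 'l) \<Rightarrow>
   ('k \<Rightarrow> 'v::ab_group_add \<Rightarrow> 'v) \<Rightarrow> ('l, 'v) lie_mod set" where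
  "fd_irreducible_modules scaleL br scale =
     {V. lie_module scaleL br scale V \<and> finite_dim scale V \<and> irreducible_mod scale V}"

definition mod_isomorphic ::
  "('k::field \<Rightarrow> 'v::ab_group_add \<Rightarrow> 'v) \<Rightarrow> ('l, 'v) lie_mod \<Rightarrow> ('l, 'v) lie_mod \<Rightarrow> bool" where
  "mod_isomorphic scale V W \<longleftrightarrow>
     (\<exists>f. bij_betw f (carrier V) (carrier W) \<and>
          (\<forall>v\<in>carrier V. \<forall>w\<in>carrier V. f (v + w) = f v + f w) \<and>
          (\<forall>c. \<forall>v\<in>carrier V. f (scale c v) = scale c (f v)) \<and>
          (\<forall>x. \<forall>v\<in>carrier V. f (act V x v) = act W x (f v)))"

definition iso_class ::
  "('k::field \<Rightarrow> 'v::ab_group_add \<Rightarrow> 'v) \<Rightarrow> ('l, 'v) lie_mod set \<Rightarrow> ('l, 'v) lie_mod \<Rightarrow> ('l, 'v) lie_mod set" where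
  "iso_class scale S V = {W \<in> S. mod_isomorphic scale V W}"

definition iso_classes ::
  "('k::field \<Rightarrow> 'v::ab_group_add \<Rightarrow> 'v) \<Rightarrow> ('l, 'v) lie_mod set \<Rightarrow> ('l, 'v) lie_mod set set" where
  "iso_classes scale S = iso_class scale S ` S"

definition act_eigenvalues ::
  "('k::field \<Rightarrow> 'v::ab_group_add \<Rightarrow> 'v) \<Rightarrow> ('l, 'v) lie_mod \<Rightarrow> 'l \<Rightarrow> 'k set" where
  "act_eigenvalues scale V x = {c. \<exists>v\<in>carrier V. v \<noteq> 0 \<and> act V x v = scale c v}"


section \<open>Lie algebras given by generators and relations\<close>

datatype ('g, 'k) lie_term =
    LGen 'g
  | LZero
  | LAdd "('g, 'k) lie_term" "('g, 'k) lie_term"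
  | LScale 'k "('g, 'k) lie_term"
  | LBr "('g, 'k) lie_term" "('g, 'k) lie_term"

text \<open>
  The Lie algebra presented by \<open>R\<close> is the set of formal Lie expressions in the generators modulo
  the smallest congruence that contains \<open>R\<close> and the Lie algebra axioms. Here \<open>-t\<close> is
  represented by \<open>LScale (-1) t\<close>.
\<close>

inductive lie_cong ::
  "(('g, 'k::field) lie_term \<times> ('g, 'k) lie_term) set \<Rightarrow> ('g, 'k) lie_term \<Rightarrow> ('g, 'k) lie_term \<Rightarrow> bool"
  for R where
  rel: "(s, t) \<in> R \<Longrightarrow> lie_cong R s t"
| refl: "lie_cong R t t"
| sym: "lie_cong R s t \<Longrightarrow> lie_cong R t s"
| trans: "lie_cong R s t \<Longrightarrow> lie_cong R t u \<Longrightarrow> lie_cong R s u"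
| cong_add: "lie_cong R s s' \<Longrightarrow> lie_cong R t t' \<Longrightarrow> lie_cong R (LAdd s t) (LAdd s' t')"
| cong_scale: "lie_cong R t t' \<Longrightarrow> lie_cong R (LScale a t) (LScale a t')"
| cong_br: "lie_cong R s s' \<Longrightarrow> lie_cong R t t' \<Longrightarrow> lie_cong R (LBr s t) (LBr s' t')"
| add_assoc: "lie_cong R (LAdd (LAdd s t) u) (LAdd s (LAdd t u))"
| add_comm: "lie_cong R (LAdd s t) (LAdd t s)"
| add_zero: "lie_cong R (LAdd LZero t) t"
| add_neg: "lie_cong R (LAdd (LScale (- 1) t) t) LZero"
| scale_add_right: "lie_cong R (LScale a (LAdd s t)) (LAdd (LScale a s) (LScale a t))"
| scale_add_left: "lie_cong R (LScale (a + b) t) (LAdd (LScale a t) (LScale b t))"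
| scale_mult: "lie_cong R (LScale a (LScale b t)) (LScale (a * b) t)"
| scale_one: "lie_cong R (LScale 1 t) t"
| br_add_left: "lie_cong R (LBr (LAdd s t) u) (LAdd (LBr s u) (LBr t u))"
| br_add_right: "lie_cong R (LBr u (LAdd s t)) (LAdd (LBr u s) (LBr u t))"
| br_scale_left: "lie_cong R (LBr (LScale a s) t) (LScale a (LBr s t))"
| br_scale_right: "lie_cong R (LBr s (LScale a t)) (LScale a (LBr s t))"
| br_self: "lie_cong R (LBr t t) LZero"
| jacobi: "lie_cong R (LAdd (LAdd (LBr s (LBr t u)) (LBr t (LBr u s))) (LBr u (LBr s t))) LZero"

lemma equivp_lie_cong: "equivp (lie_cong R)"
  by (intro equivpI reflpI sympI transpI)
    (rule lie_cong.refl, erule lie_cong.sym, erule (1) lie_cong.trans)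


section \<open>The Onsager algebra\<close>

datatype onsager_gen = OX | OY

definition onsager_rel :: "((onsager_gen, 'k::field) lie_term \<times> (onsager_gen, 'k) lie_term) set" where
  "onsager_rel =
     (let X = LGen OX; Y = LGen OY in
      {(LBr X (LBr X (LBr X Y)), LScale 4 (LBr X Y)),
       (LBr Y (LBr Y (LBr Y X)), LScale 4 (LBr Y X))})"

quotient_type (overloaded) 'k onsager = "(onsager_gen, 'k::field) lie_term" / "lie_cong onsager_rel"
  by (rule equivp_lie_cong)

lift_definition onsager_scale :: "'k::field \<Rightarrow> 'k onsager \<Rightarrow> 'k onsager" is LScale
  by (rule lie_cong.cong_scale)

lift_definition onsager_br :: "'k::field onsager \<Rightarrow> 'k onsager \<Rightarrow> 'k onsager" is LBr
  by (rule lie_cong.cong_br)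

lift_definition onsager_X :: "'k::field onsager" is "LGen OX" .

lift_definition onsager_Y :: "'k::field onsager" is "LGen OY" .

instantiation onsager :: (field) ab_group_add
begin

lift_definition zero_onsager :: "'a onsager" is LZero .

lift_definition plus_onsager :: "'a onsager \<Rightarrow> 'a onsager \<Rightarrow> 'a onsager" is LAdd
  by (rule lie_cong.cong_add)

lift_definition uminus_onsager :: "'a onsager \<Rightarrow> 'a onsager" is "LScale (- 1)"
  by (rule lie_cong.cong_scale)

definition minus_onsager :: "'a onsager \<Rightarrow> 'a onsager \<Rightarrow> 'a onsager" where
  "minus_onsager x y = x + - y"

instance
proof
  fix a b c :: "'a onsager"
  show "a + b + c = a + (b + c)" by transfer (rule lie_cong.add_assoc)
  show "a + b = b + a" by transfer (rule lie_cong.add_comm)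
  show "0 + a = a" by transfer (rule lie_cong.add_zero)
  show "- a + a = 0" by transfer (rule lie_cong.add_neg)
  show "a - b = a + - b" by (rule minus_onsager_def)
qed

end

lemma lie_algebra_onsager: "lie_algebra onsager_scale (onsager_br :: 'k::field onsager \<Rightarrow> _)"
proof unfold_locales
  fix a b :: 'k and x y z :: "'k onsager"
  show "onsager_scale a (x + y) = onsager_scale a x + onsager_scale a y"
    by transfer (rule lie_cong.scale_add_right)
  show "onsager_scale (a + b) x = onsager_scale a x + onsager_scale b x"
    by transfer (rule lie_cong.scale_add_left)
  show "onsager_scale a (onsager_scale b x) = onsager_scale (a * b) x"
    by transfer (rule lie_cong.scale_mult)
  show "onsager_scale 1 x = x"
    by transfer (rule lie_cong.scale_one)
  show "onsager_br (x + y) z = onsager_br x z + onsager_br y z"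
    by transfer (rule lie_cong.br_add_left)
  show "onsager_br z (x + y) = onsager_br z x + onsager_br z y"
    by transfer (rule lie_cong.br_add_right)
  show "onsager_br (onsager_scale a x) y = onsager_scale a (onsager_br x y)"
    by transfer (rule lie_cong.br_scale_left)
  show "onsager_br x (onsager_scale a y) = onsager_scale a (onsager_br x y)"
    by transfer (rule lie_cong.br_scale_right)
  show "onsager_br x x = 0"
    by transfer (rule lie_cong.br_self)
  show "onsager_br x (onsager_br y z) + onsager_br y (onsager_br z x) + onsager_br z (onsager_br x y) = 0"
    by transfer (rule lie_cong.jacobi)
qed

lemma onsager_relations:
  fixes X Y :: "'k::field onsager"
  defines "X \<equiv> onsager_X" and "Y \<equiv> onsager_Y"
  shows "onsager_br X (onsager_br X (onsager_br X Y)) = onsager_scale 4 (onsager_br X Y)"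
    and "onsager_br Y (onsager_br Y (onsager_br Y X)) = onsager_scale 4 (onsager_br Y X)"
  unfolding X_def Y_def
  by (transfer, rule lie_cong.rel, simp add: onsager_rel_def Let_def)+

definition onsager_type ::
  "('k::field \<Rightarrow> 'v::ab_group_add \<Rightarrow> 'v) \<Rightarrow> ('k onsager, 'v) lie_mod \<Rightarrow> 'k \<times> 'k \<Rightarrow> bool" where
  "onsager_type scale V = (\<lambda>(\<alpha>, \<alpha>'). \<exists>d::nat.
     act_eigenvalues scale V onsager_X = {of_nat d - 2 * of_nat i + \<alpha> | i. i \<le> d} \<and>
     act_eigenvalues scale V onsager_Y = {of_nat d - 2 * of_nat i + \<alpha>' | i. i \<le> d})"

definition onsager_irreps_of_type ::
  "('k::field \<Rightarrow> 'v::ab_group_add \<Rightarrow> 'v) \<Rightarrow> 'k \<times> 'k \<Rightarrow> ('k onsager, 'v) lie_mod set" where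
  "onsager_irreps_of_type scale p =
     {V \<in> fd_irreducible_modules onsager_scale onsager_br scale. onsager_type scale V p}"


section \<open>The tetrahedron algebra\<close>

typedef tet_gen = "{(r, s). r \<in> {0, 1, 2, 3::nat} \<and> s \<in> {0, 1, 2, 3} \<and> r \<noteq> s}"
  by (rule exI[of _ "(0, 1)"]) simp

abbreviation tet_gen_term :: "nat \<Rightarrow> nat \<Rightarrow> (tet_gen, 'k) lie_term" where
  "tet_gen_term r s \<equiv> LGen (Abs_tet_gen (r, s))"

inductive_set tet_rel :: "((tet_gen, 'k::field) lie_term \<times> (tet_gen, 'k) lie_term) set" where
  skew: "distinct [r, s] \<Longrightarrow> {r, s} \<subseteq> {0, 1, 2, 3} \<Longrightarrow>
    (LAdd (tet_gen_term r s) (tet_gen_term s r), LZero) \<in> tet_rel"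
| adjacent: "distinct [r, s, t] \<Longrightarrow> {r, s, t} \<subseteq> {0, 1, 2, 3} \<Longrightarrow>
    (LBr (tet_gen_term r s) (tet_gen_term s t),
     LAdd (LScale 2 (tet_gen_term r s)) (LScale 2 (tet_gen_term s t))) \<in> tet_rel"
| opposite: "distinct [r, s, t, u] \<Longrightarrow> {r, s, t, u} \<subseteq> {0, 1, 2, 3} \<Longrightarrow>
    (LBr (tet_gen_term r s) (LBr (tet_gen_term r s) (LBr (tet_gen_term r s) (tet_gen_term t u))),
     LScale 4 (LBr (tet_gen_term r s) (tet_gen_term t u))) \<in> tet_rel"

quotient_type (overloaded) 'k tetrahedron = "(tet_gen, 'k::field) lie_term" / "lie_cong tet_rel"
  by (rule equivp_lie_cong)

lift_definition tet_scale :: "'k::field \<Rightarrow> 'k tetrahedron \<Rightarrow> 'k tetrahedron" is LScale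
  by (rule lie_cong.cong_scale)

lift_definition tet_br :: "'k::field tetrahedron \<Rightarrow> 'k tetrahedron \<Rightarrow> 'k tetrahedron" is LBr
  by (rule lie_cong.cong_br)

text \<open>\<open>tet_X r s\<close> is only meaningful for distinct \<open>r\<close> and \<open>s\<close> in \<open>{0, 1, 2, 3}\<close>.\<close>

lift_definition tet_X :: "nat \<Rightarrow> nat \<Rightarrow> 'k::field tetrahedron" is tet_gen_term .

instantiation tetrahedron :: (field) ab_group_add
begin

lift_definition zero_tetrahedron :: "'a tetrahedron" is LZero .

lift_definition plus_tetrahedron :: "'a tetrahedron \<Rightarrow> 'a tetrahedron \<Rightarrow> 'a tetrahedron" is LAdd
  by (rule lie_cong.cong_add)

lift_definition uminus_tetrahedron :: "'a tetrahedron \<Rightarrow> 'a tetrahedron" is "LScale (- 1)"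
  by (rule lie_cong.cong_scale)

definition minus_tetrahedron :: "'a tetrahedron \<Rightarrow> 'a tetrahedron \<Rightarrow> 'a tetrahedron" where
  "minus_tetrahedron x y = x + - y"

instance
proof
  fix a b c :: "'a tetrahedron"
  show "a + b + c = a + (b + c)" by transfer (rule lie_cong.add_assoc)
  show "a + b = b + a" by transfer (rule lie_cong.add_comm)
  show "0 + a = a" by transfer (rule lie_cong.add_zero)
  show "- a + a = 0" by transfer (rule lie_cong.add_neg)
  show "a - b = a + - b" by (rule minus_tetrahedron_def)
qed

end

lemma lie_algebra_tetrahedron: "lie_algebra tet_scale (tet_br :: 'k::field tetrahedron \<Rightarrow> _)"
proof unfold_locales
  fix a b :: 'k and x y z :: "'k tetrahedron"
  show "tet_scale a (x + y) = tet_scale a x + tet_scale a y"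
    by transfer (rule lie_cong.scale_add_right)
  show "tet_scale (a + b) x = tet_scale a x + tet_scale b x"
    by transfer (rule lie_cong.scale_add_left)
  show "tet_scale a (tet_scale b x) = tet_scale (a * b) x"
    by transfer (rule lie_cong.scale_mult)
  show "tet_scale 1 x = x"
    by transfer (rule lie_cong.scale_one)
  show "tet_br (x + y) z = tet_br x z + tet_br y z"
    by transfer (rule lie_cong.br_add_left)
  show "tet_br z (x + y) = tet_br z x + tet_br z y"
    by transfer (rule lie_cong.br_add_right)
  show "tet_br (tet_scale a x) y = tet_scale a (tet_br x y)"
    by transfer (rule lie_cong.br_scale_left)
  show "tet_br x (tet_scale a y) = tet_scale a (tet_br x y)"
    by transfer (rule lie_cong.br_scale_right)
  show "tet_br x x = 0"
    by transfer (rule lie_cong.br_self)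
  show "tet_br x (tet_br y z) + tet_br y (tet_br z x) + tet_br z (tet_br x y) = 0"
    by transfer (rule lie_cong.jacobi)
qed

lemma tet_relations:
  shows "distinct [r, s] \<Longrightarrow> {r, s} \<subseteq> {0, 1, 2, 3} \<Longrightarrow> tet_X r s + tet_X s r = (0 :: 'k::field tetrahedron)"
    and "distinct [r, s, t] \<Longrightarrow> {r, s, t} \<subseteq> {0, 1, 2, 3} \<Longrightarrow>
      tet_br (tet_X r s) (tet_X s t) = tet_scale (2::'k) (tet_X r s) + tet_scale 2 (tet_X s t)"
    and "distinct [r, s, t, u] \<Longrightarrow> {r, s, t, u} \<subseteq> {0, 1, 2, 3} \<Longrightarrow>
      tet_br (tet_X r s) (tet_br (tet_X r s) (tet_br (tet_X r s) (tet_X t u))) =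
      tet_scale (4::'k) (tet_br (tet_X r s) (tet_X t u))"
    apply (transfer, rule lie_cong.rel, erule (1) tet_rel.skew)
   apply (transfer, rule lie_cong.rel, erule (1) tet_rel.adjacent)
  apply (transfer, rule lie_cong.rel, erule (1) tet_rel.opposite)
  done

abbreviation tet_irreps ::
  "('k::field \<Rightarrow> 'v::ab_group_add \<Rightarrow> 'v) \<Rightarrow> ('k tetrahedron, 'v) lie_mod set" where
  "tet_irreps scale \<equiv> fd_irreducible_modules tet_scale tet_br scale"


section \<open>From modules of the tetrahedron algebra to modules of the Onsager algebra\<close>

definition onsager_restriction ::
  "('k::field \<Rightarrow> 'v::ab_group_add \<Rightarrow> 'v) \<Rightarrow>
   ('k tetrahedron, 'v) lie_mod \<Rightarrow> ('k onsager, 'v) lie_mod \<Rightarrow> bool" where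
  "onsager_restriction scale V W \<longleftrightarrow>
     lie_module onsager_scale onsager_br scale W \<and>
     carrier W = carrier V \<and>
     (\<forall>v\<in>carrier V. act W onsager_X v = act V (tet_X 0 1) v) \<and>
     (\<forall>v\<in>carrier V. act W onsager_Y v = act V (tet_X 2 3) v)"

end

theory Submission
  imports Defs
begin

text \<open>
  Let \<open>A\<close> and \<open>B\<close> be the actions of \<open>X\<^sub>0\<^sub>1\<close> and \<open>X\<^sub>2\<^sub>3\<close>. On an irreducible Onsager module of type \<open>(0, 0)\<close>,
  the split decomposition yields an operator \<open>P\<close> with \<open>[A, P] = 2A + 2P\<close> and \<open>[P, B] = 2P + 2B\<close>, which
  is the action of \<open>X\<^sub>1\<^sub>2\<close>; changing the signs of \<open>A\<close> and \<open>B\<close> gives \<open>X\<^sub>1\<^sub>3\<close>, \<open>X\<^sub>0\<^sub>2\<close> and \<open>X\<^sub>0\<^sub>3\<close>. Everything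
  else rests on one principle: a linear map \<open>T\<close> on the module with \<open>[A, T] = aT\<close> and \<open>[B, T] = bT\<close>
  has an invariant kernel, so \<open>T = 0\<close> as soon as it kills an extremal eigenvector of \<open>A\<close> or \<open>B\<close>. Applied
  to the defects of the remaining relations of the tetrahedron algebra, it shows that they hold; applied
  to the difference of two candidates for \<open>P\<close>, it shows that \<open>P\<close> is unique and preserves Onsager
  submodules of a tetrahedron module and isomorphisms of Onsager modules.
\<close>

section \<open>Operators on a subspace\<close>

text \<open>Type (0, 0) is what permits the sign changes. The Dolan-Grady relations survive negating
  \<open>A\<close> or \<open>B\<close>, and each of \<open>X\<^sub>1\<^sub>2\<close>,
  \<open>X\<^sub>1\<^sub>3\<close>, \<open>X\<^sub>0\<^sub>2\<close>,
  \<open>X\<^sub>0\<^sub>3\<close> is the middle of a path from A or -A to B or -B. The split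
  decomposition needs the same spectrum at both ends; as d, d - 2, ..., -d is symmetric, all four
  choices of signs qualify. Extremal vectors matter because [A, T] = aT shifts the eigenvalues of A
  by a: at the right end of the spectrum the shift leaves it. The obstacle is the restriction of a
  tetrahedron module V. Neither its irreducibility nor its spectrum is known in advance, so the
  argument runs on a minimal submodule W, while the other generators still map W into V, where A may
  have eigenvalues beyond those on W. Its substitute compares eigenvalues of A and B through an
  operator P between them, which satisfies two polynomials whose roots run in opposite
  directions.\<close>

locale alg_closed_space = vector_space scale
  for scale :: "'k::{alg_closed_field, field_char_0} \<Rightarrow> 'v::ab_group_add \<Rightarrow> 'v" (infixr \<open>\<cdot>\<close> 75)
begin

text \<open>\<open>act\<close> is constrained on the carrier only, so linearity is relative to
  \<open>V\<close>, and values outside \<open>V\<close> are left free.\<close>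

definition lin :: "'v set \<Rightarrow> 'v set \<Rightarrow> ('v \<Rightarrow> 'v) \<Rightarrow> bool" where
  "lin V W f \<longleftrightarrow> subspace V \<and> subspace W \<and> (\<forall>v\<in>V. f v \<in> W) \<and>
     (\<forall>v\<in>V. \<forall>w\<in>V. f (v + w) = f v + f w) \<and> (\<forall>c. \<forall>v\<in>V. f (c \<cdot> v) = c \<cdot> f v)"

lemma linI:
  assumes "subspace V" "subspace W" "\<And>v. v \<in> V \<Longrightarrow> f v \<in> W"
    "\<And>v w. v \<in> V \<Longrightarrow> w \<in> V \<Longrightarrow> f (v + w) = f v + f w"
    "\<And>c v. v \<in> V \<Longrightarrow> f (c \<cdot> v) = c \<cdot> f v"
  shows "lin V W f"
  using assms unfolding lin_def by blast

context
  fixes V W f assumes f: "lin V W f"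
begin

lemma lin_subspaces: "subspace V" "subspace W"
  using f by (auto simp: lin_def)

lemma lin_mem: "v \<in> V \<Longrightarrow> f v \<in> W"
  using f by (auto simp: lin_def)

lemma lin_add: "v \<in> V \<Longrightarrow> w \<in> V \<Longrightarrow> f (v + w) = f v + f w"
  using f by (auto simp: lin_def)

lemma lin_scale: "v \<in> V \<Longrightarrow> f (c \<cdot> v) = c \<cdot> f v"
  using f by (auto simp: lin_def)

lemma lin_zero: "f 0 = 0"
  using lin_scale[of 0 0] subspace_0[OF lin_subspaces(1)] by simp

lemma lin_minus: "v \<in> V \<Longrightarrow> f (- v) = - f v"
  using lin_scale[of v "-1"] by simp

lemma lin_diff: "v \<in> V \<Longrightarrow> w \<in> V \<Longrightarrow> f (v - w) = f v - f w"
  using lin_add[of v "- w"] lin_minus[of w] subspace_neg[OF lin_subspaces(1), of w] by simp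

lemma subspace_preimage: "subspace U \<Longrightarrow> subspace {v \<in> V. f v \<in> U}"
  using lin_subspaces(1) by (simp add: subspace_def lin_zero lin_add lin_scale)

lemma lin_mono:
  "subspace V' \<Longrightarrow> V' \<subseteq> V \<Longrightarrow> subspace W' \<Longrightarrow> (\<And>v. v \<in> V' \<Longrightarrow> f v \<in> W') \<Longrightarrow> lin V' W' f"
  by (rule linI) (auto intro: lin_add lin_scale)

end

lemmas subspace_mem = subspace_0 subspace_add subspace_diff subspace_neg subspace_scale

lemmas lin_simps = lin_add lin_scale lin_minus lin_diff lin_mem

abbreviation neg :: "('v \<Rightarrow> 'v) \<Rightarrow> 'v \<Rightarrow> 'v" where
  "neg f \<equiv> \<lambda>v. - f v"

lemma lin_neg: "lin V W f \<Longrightarrow> lin V W (neg f)"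
  by (frule lin_subspaces(1), frule lin_subspaces(2), rule linI)
    (simp_all add: lin_simps subspace_mem)

lemma lin_sub: "lin V W f \<Longrightarrow> lin V W g \<Longrightarrow> lin V W (\<lambda>v. f v - g v)"
  by (frule lin_subspaces(1), frule lin_subspaces(2), rule linI)
    (simp_all add: lin_simps subspace_mem scale_right_diff_distrib)

lemma lin_plus: "lin V W f \<Longrightarrow> lin V W g \<Longrightarrow> lin V W (\<lambda>v. f v + g v)"
  by (frule lin_subspaces(1), frule lin_subspaces(2), rule linI)
    (simp_all add: lin_simps subspace_mem scale_right_distrib add_ac)

lemma lin_scaled: "lin V W f \<Longrightarrow> lin V W (\<lambda>v. c \<cdot> f v)"
  by (frule lin_subspaces(1), frule lin_subspaces(2), rule linI)
    (simp_all add: lin_simps subspace_mem scale_right_distrib mult.commute)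

lemma lin_comp: "lin V W f \<Longrightarrow> lin U V g \<Longrightarrow> lin U W (\<lambda>v. f (g v))"
  by (frule lin_subspaces(1), frule lin_subspaces(2), frule lin_subspaces(1)[of U], rule linI)
    (simp_all add: lin_simps subspace_mem)

lemma lin_zero_map: "subspace V \<Longrightarrow> subspace W \<Longrightarrow> lin V W (\<lambda>v. 0)"
  by (rule linI) (auto intro: subspace_0)

text \<open>Irreducibility of an Onsager module in terms of its two generators. Without the algebra
  in the notation, the operators can be swapped and negated freely.\<close>

definition irr :: "'v set \<Rightarrow> ('v \<Rightarrow> 'v) \<Rightarrow> ('v \<Rightarrow> 'v) \<Rightarrow> bool" where
  "irr V A B \<longleftrightarrow> V \<noteq> {0} \<and> lin V V A \<and> lin V V B \<and>
     (\<forall>W. subspace W \<longrightarrow> W \<subseteq> V \<longrightarrow> (\<forall>w\<in>W. A w \<in> W) \<longrightarrow> (\<forall>w\<in>W. B w \<in> W) \<longrightarrow> W = {0} \<or> W = V)"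

lemma irrD:
  assumes "irr V A B"
  shows "V \<noteq> {0}" "lin V V A" "lin V V B"
    and "subspace W \<Longrightarrow> W \<subseteq> V \<Longrightarrow> (\<And>w. w \<in> W \<Longrightarrow> A w \<in> W) \<Longrightarrow> (\<And>w. w \<in> W \<Longrightarrow> B w \<in> W)
      \<Longrightarrow> W = {0} \<or> W = V"
  using assms unfolding irr_def by blast+

lemma irr_swap: "irr V A B \<Longrightarrow> irr V B A"
  unfolding irr_def by blast

lemma neg_mem_iff: "subspace W \<Longrightarrow> - x \<in> W \<longleftrightarrow> x \<in> W"
  using subspace_neg[of W x] subspace_neg[of W "- x"] by auto

lemma irr_neg: "irr V A B \<Longrightarrow> irr V (neg A) B"
  unfolding irr_def by (auto simp: lin_neg neg_mem_iff)

text \<open>The kernel of such a \<open>T\<close> is a submodule.\<close>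

lemma irr_intertwiner_zero:
  assumes irr: "irr V A B" and T: "lin V W T" and "A' 0 = 0" "B' 0 = 0"
    and A: "\<And>v. v \<in> V \<Longrightarrow> A' (T v) = T (A v) + a \<cdot> T v"
    and B: "\<And>v. v \<in> V \<Longrightarrow> B' (T v) = T (B v) + b \<cdot> T v"
    and v: "v \<in> V" "v \<noteq> 0" "T v = 0" and w: "w \<in> V"
  shows "T w = 0"
proof -
  let ?K = "{v \<in> V. T v \<in> {0}}"
  have "?K = {0} \<or> ?K = V"
  proof (rule irrD(4)[OF irr])
    show "subspace ?K" by (rule subspace_preimage[OF T]) simp
    show "A u \<in> ?K" "B u \<in> ?K" if "u \<in> ?K" for u
      using that A[of u] B[of u] assms(3,4) irrD(2,3)[OF irr] by (auto simp: lin_mem)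
  qed auto
  with v w show ?thesis by auto
qed

subsection \<open>Eigenvalues and sums of eigenspaces\<close>

definition eigs :: "'v set \<Rightarrow> ('v \<Rightarrow> 'v) \<Rightarrow> 'k set" where
  "eigs V A = {c. \<exists>v\<in>V. v \<noteq> 0 \<and> A v = c \<cdot> v}"

text \<open>Diagonalizability is expressed as \<open>esum V A S = V\<close>. Elements of
  \<open>S\<close> that are not eigenvalues contribute only the zero vector.\<close>

definition esum :: "'v set \<Rightarrow> ('v \<Rightarrow> 'v) \<Rightarrow> 'k set \<Rightarrow> 'v set" where
  "esum V A S = span {v \<in> V. \<exists>c\<in>S. A v = c \<cdot> v}"

lemma subspace_esum: "subspace (esum V A S)"
  by (simp add: esum_def)

lemma esum_base: "v \<in> V \<Longrightarrow> c \<in> S \<Longrightarrow> A v = c \<cdot> v \<Longrightarrow> v \<in> esum V A S"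
  unfolding esum_def by (rule span_base) auto

lemma esum_mono: "V \<subseteq> V' \<Longrightarrow> S \<subseteq> S' \<Longrightarrow> esum V A S \<subseteq> esum V' A S'"
  unfolding esum_def by (rule span_mono) auto

lemma esum_least:
  assumes "subspace U" "\<And>v c. v \<in> V \<Longrightarrow> c \<in> S \<Longrightarrow> A v = c \<cdot> v \<Longrightarrow> v \<in> U"
  shows "esum V A S \<subseteq> U"
  unfolding esum_def by (rule span_minimal) (use assms in auto)

lemma esum_subset: "subspace V \<Longrightarrow> esum V A S \<subseteq> V"
  by (rule esum_least)

lemma esum_map:
  assumes T: "lin V W T" and U: "subspace U"
    and "\<And>v c. v \<in> V \<Longrightarrow> c \<in> S \<Longrightarrow> A v = c \<cdot> v \<Longrightarrow> T v \<in> U" and "v \<in> esum V A S"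
  shows "T v \<in> U"
proof -
  have "esum V A S \<subseteq> {v \<in> V. T v \<in> U}"
    using assms by (intro esum_least subspace_preimage[OF T]) auto
  with assms(4) show ?thesis by auto
qed

lemma esum_eigs: "esum V A S \<subseteq> esum V A (S \<inter> eigs V A)"
proof (rule esum_least[OF subspace_esum])
  fix v c assume "v \<in> V" "c \<in> S" "A v = c \<cdot> v"
  then show "v \<in> esum V A (S \<inter> eigs V A)"
    by (cases "v = 0") (auto simp: eigs_def subspace_0[OF subspace_esum] intro!: esum_base)
qed

lemma esum_empty: "esum V A {} = {0}"
  by (simp add: esum_def)

text \<open>\<open>A - c\<close> kills the eigenspace for \<open>c\<close> and rescales the
  others.\<close>

lemma esum_shift:
  assumes A: "lin V V A" and v: "v \<in> esum V A (insert c S)"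
  shows "A v - c \<cdot> v \<in> esum V A S"
proof (rule esum_map[OF _ subspace_esum _ v])
  note V = lin_subspaces(1)[OF A]
  show "lin V V (\<lambda>v. A v - c \<cdot> v)"
    by (rule linI[OF V V]) (use A V in \<open>simp_all add: lin_simps subspace_mem scale_right_distrib
      scale_right_diff_distrib mult.commute\<close>)
  fix v d assume "v \<in> V" "d \<in> insert c S" "A v = d \<cdot> v"
  then show "A v - c \<cdot> v \<in> esum V A S"
    using esum_base[of v V d S A]
    by (auto simp: subspace_0[OF subspace_esum] subspace_diff[OF subspace_esum]
        subspace_scale[OF subspace_esum])
qed

lemma esum_invariant:
  assumes A: "lin V V A" and v: "v \<in> esum V A S"
  shows "A v \<in> esum V A S"
  by (rule esum_map[OF A subspace_esum _ v]) (simp add: subspace_scale[OF subspace_esum] esum_base)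

text \<open>\<open>A - s\<close> turns a sum over \<open>insert s S\<close> into one over
  \<open>S\<close> and multiplies \<open>v\<close> by \<open>c - s\<close>, which is
  nonzero.\<close>

lemma esum_eigenvector:
  assumes A: "lin V V A" and "finite S" "v \<in> esum V A S" "A v = c \<cdot> v" "c \<notin> S"
  shows "v = 0"
  using assms(2-)
proof (induction S arbitrary: v rule: finite_induct)
  case empty
  then show ?case by (simp add: esum_empty)
next
  case (insert s S)
  have "v \<in> V" using insert.prems(1) esum_subset[OF lin_subspaces(1)[OF A]] by blast
  have "A v - s \<cdot> v = 0"
  proof (rule insert.IH)
    show "A v - s \<cdot> v \<in> esum V A S" by (rule esum_shift[OF A insert.prems(1)])
    show "A (A v - s \<cdot> v) = c \<cdot> (A v - s \<cdot> v)"
      using insert.prems(2) \<open>v \<in> V\<close> lin_subspaces(1)[OF A]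
      by (simp add: lin_simps[OF A] subspace_mem scale_right_diff_distrib mult.commute)
  qed (use insert.prems in auto)
  then have "(c - s) \<cdot> v = 0" using insert.prems by (simp add: scale_left_diff_distrib)
  then show ?case using insert.prems by auto
qed

lemma esum_eq_imp_eigs_subset:
  assumes "lin V V A" "finite S" "esum V A S = V"
  shows "eigs V A \<subseteq> S"
  using esum_eigenvector[OF assms(1,2)] assms(3) unfolding eigs_def by auto

lemma neg_eq_scale_iff: "- x = c \<cdot> v \<longleftrightarrow> x = (- c) \<cdot> v"
  by (metis minus_minus scale_minus_left)

lemma mem_uminus_image_iff: "c \<in> uminus ` S \<longleftrightarrow> - c \<in> S" for c :: "'a::group_add"
  by (metis (no_types) image_eqI imageE minus_minus)

lemma eigs_neg: "eigs V (neg A) = uminus ` eigs V A"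
proof (rule set_eqI)
  fix c
  show "c \<in> eigs V (neg A) \<longleftrightarrow> c \<in> uminus ` eigs V A"
    unfolding mem_uminus_image_iff by (simp add: eigs_def neg_eq_scale_iff)
qed

lemma esum_neg: "esum V (neg A) S = esum V A (uminus ` S)"
  by (simp add: esum_def neg_eq_scale_iff)

subsection \<open>Products of linear factors of an operator\<close>

text \<open>An annihilating polynomial is kept as the list of its roots with multiplicity: only the
  position of the roots matters, and \<open>P\<close> is not known to be diagonalizable.\<close>

fun factors :: "('v \<Rightarrow> 'v) \<Rightarrow> 'k list \<Rightarrow> 'v \<Rightarrow> 'v" where
  "factors P [] v = v"
| "factors P (r # rs) v = factors P rs (P v - r \<cdot> v)"

lemma factors_append: "factors P (rs @ ss) v = factors P ss (factors P rs v)"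
  by (induction rs arbitrary: v) auto

context
  fixes V P assumes P: "lin V V P"
begin

lemma lin_factor: "lin V V (\<lambda>v. P v - r \<cdot> v)"
  by (rule linI) (use P lin_subspaces[OF P] in \<open>simp_all add: lin_simps subspace_mem
    scale_right_distrib scale_right_diff_distrib mult.commute\<close>)

lemma lin_factors: "lin V V (factors P rs)"
proof (induction rs)
  case Nil
  show ?case by (rule linI) (use lin_subspaces[OF P] in auto)
next
  case (Cons r rs)
  then show ?case using lin_comp[OF Cons lin_factor, of r] by (simp add: lin_def)
qed

lemma factors_commute1: "v \<in> V \<Longrightarrow> factors P rs (P v) = P (factors P rs v)"
proof (induction rs arbitrary: v)
  case (Cons r rs)
  have V: "subspace V" using lin_subspaces[OF P] by simp
  have "factors P rs (P (P v) - r \<cdot> P v) = factors P rs (P (P v - r \<cdot> v))"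
    using Cons.prems V by (simp add: lin_simps[OF P] subspace_mem)
  also have "\<dots> = P (factors P rs (P v - r \<cdot> v))"
    using Cons.prems V by (intro Cons.IH) (simp add: lin_simps[OF P] subspace_mem)
  finally show ?case by simp
qed simp

lemma factors_factor: "v \<in> V \<Longrightarrow> factors P rs (P v - r \<cdot> v) = P (factors P rs v) - r \<cdot> factors P rs v"
  using lin_subspaces[OF P]
  by (simp add: lin_simps[OF lin_factors] lin_mem[OF P] subspace_mem factors_commute1)

lemma factors_commute: "v \<in> V \<Longrightarrow> factors P rs (factors P ss v) = factors P ss (factors P rs v)"
proof (induction ss arbitrary: v)
  case (Cons s ss)
  then show ?case using factors_factor[of v rs s] by (simp add: lin_mem[OF lin_factor])
qed simp

lemma factors_eigenvector:
  "v \<in> V \<Longrightarrow> P v = c \<cdot> v \<Longrightarrow> factors P rs v = (\<Prod>r\<leftarrow>rs. c - r) \<cdot> v"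
proof (induction rs)
  case (Cons r rs)
  have "factors P (r # rs) v = factors P rs ((c - r) \<cdot> v)"
    using Cons.prems by (simp add: scale_left_diff_distrib)
  also have "\<dots> = (c - r) \<cdot> factors P rs v"
    using Cons.prems by (intro lin_scale[OF lin_factors])
  finally show ?case using Cons by simp
qed simp

text \<open>By induction the last remaining factor \<open>P - r\<close> already kills
  \<open>v\<close>. Then the other product acts on \<open>v\<close> as the scalar with factors
  \<open>r - s\<close>, none of which vanishes.\<close>

lemma factors_coprime:
  "v \<in> V \<Longrightarrow> factors P rs v = 0 \<Longrightarrow> factors P ss v = 0 \<Longrightarrow> set rs \<inter> set ss = {} \<Longrightarrow> v = 0"
proof (induction rs arbitrary: v)
  case (Cons r rs)
  have "P v - r \<cdot> v = 0"
  proof (rule Cons.IH)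
    show "P v - r \<cdot> v \<in> V" using lin_mem[OF lin_factor] Cons.prems by blast
    show "factors P ss (P v - r \<cdot> v) = 0"
      using Cons.prems by (simp add: factors_factor lin_zero[OF P])
  qed (use Cons.prems in auto)
  then have "(\<Prod>s\<leftarrow>ss. r - s) \<cdot> v = 0"
    using factors_eigenvector[of v r ss] Cons.prems by simp
  moreover have "(\<Prod>s\<leftarrow>ss. r - s) \<noteq> 0"
    using Cons.prems(4) by (auto simp: prod_list_zero_iff)
  ultimately show ?case by auto
qed simp

text \<open>The last nonzero vector among the partial products is an eigenvector.\<close>

lemma factors_zero_imp_eigenvalue:
  "v \<in> V \<Longrightarrow> v \<noteq> 0 \<Longrightarrow> factors P rs v = 0 \<Longrightarrow> eigs V P \<noteq> {}"
proof (induction rs arbitrary: v)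
  case (Cons r rs)
  show ?case
  proof (cases "P v - r \<cdot> v = 0")
    case True
    then show ?thesis using Cons.prems unfolding eigs_def by auto
  next
    case False
    then show ?thesis using Cons lin_mem[OF lin_factor] by (metis factors.simps(2))
  qed
qed simp

lemma eigs_subset_roots:
  assumes "\<And>v. v \<in> V \<Longrightarrow> factors P rs v = 0"
  shows "eigs V P \<subseteq> set rs"
proof
  fix c assume "c \<in> eigs V P"
  then obtain v where "v \<in> V" "v \<noteq> 0" "P v = c \<cdot> v" unfolding eigs_def by blast
  then have "(\<Prod>r\<leftarrow>rs. c - r) = 0" using assms factors_eigenvector[of v c rs] by auto
  then show "c \<in> set rs" by (auto simp: prod_list_zero_iff)
qed

end


section \<open>Annihilating polynomials and minimal invariant subspaces\<close>

definition peval :: "('v \<Rightarrow> 'v) \<Rightarrow> 'k poly \<Rightarrow> 'v \<Rightarrow> 'v" where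
  "peval A p v = (\<Sum>i\<le>degree p. coeff p i \<cdot> (A ^^ i) v)"

lemma peval_eq_sum: "degree p \<le> n \<Longrightarrow> peval A p v = (\<Sum>i\<le>n. coeff p i \<cdot> (A ^^ i) v)"
  unfolding peval_def by (intro sum.mono_neutral_left) (auto simp: coeff_eq_0)

lemma peval_pCons: "peval A (pCons c p) v = c \<cdot> v + peval A p (A v)"
proof -
  have "peval A (pCons c p) v = (\<Sum>i\<le>Suc (degree p). coeff (pCons c p) i \<cdot> (A ^^ i) v)"
    by (rule peval_eq_sum[OF degree_pCons_le])
  also have "\<dots> = c \<cdot> v + (\<Sum>i\<le>degree p. coeff p i \<cdot> (A ^^ Suc i) v)"
    by (subst sum.atMost_Suc_shift) simp
  finally show ?thesis by (simp add: peval_def funpow_swap1)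
qed

lemma peval_0: "peval A 0 v = 0"
  by (simp add: peval_def)

lemma peval_add: "peval A (p + q) v = peval A p v + peval A q v"
  using peval_eq_sum[of p "max (degree p) (degree q)" A v]
    peval_eq_sum[of q "max (degree p) (degree q)" A v] peval_eq_sum[OF degree_add_le_max, of A p q v]
  by (simp add: scale_left_distrib sum.distrib)

lemma peval_smult: "peval A (smult c p) v = c \<cdot> peval A p v"
  by (simp add: peval_eq_sum[OF degree_smult_le] scale_sum_right) (simp add: peval_def scale_sum_right)

lemma peval_monom: "peval A (monom c n) v = c \<cdot> (A ^^ n) v"
proof -
  have "peval A (monom c n) v = (\<Sum>i\<le>n. (if i = n then c \<cdot> (A ^^ n) v else 0))"
    unfolding peval_eq_sum[OF degree_monom_le] by (intro sum.cong) auto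
  then show ?thesis by simp
qed

context
  fixes V A assumes A: "lin V V A"
begin

lemma lin_peval: "lin V V (peval A p)"
proof (induction p)
  case 0
  show ?case using lin_subspaces[OF A] lin_zero_map by (simp add: peval_0[abs_def])
next
  case (pCons c p)
  have "lin V V (\<lambda>v. v)" using lin_subspaces[OF A] by (auto intro: linI)
  from lin_plus[OF lin_scaled[OF this] lin_comp[OF pCons(2) A]]
  show ?case by (simp add: peval_pCons[abs_def])
qed

text \<open>Algebraic closedness enters here: a root \<open>z\<close> of \<open>p\<close> is split
  off, and the quotient annihilates \<open>A v - z \<cdot> v\<close>.\<close>

lemma peval_zero_imp_factors_zero:
  "p \<noteq> 0 \<Longrightarrow> v \<in> V \<Longrightarrow> peval A p v = 0 \<Longrightarrow> \<exists>rs. factors A rs v = 0"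
proof (induction "degree p" arbitrary: p v rule: less_induct)
  case less
  show ?case
  proof (cases "degree p = 0")
    case True
    then obtain c where "p = [:c:]" by (metis degree_eq_zeroE)
    with less.prems have "factors A [] v = 0" by (simp add: peval_pCons peval_0)
    then show ?thesis by blast
  next
    case False
    then obtain z where "poly p z = 0" using alg_closed_imp_poly_has_root[of p] by auto
    then obtain q where p: "p = [:- z, 1:] * q" unfolding poly_eq_0_iff_dvd by (elim dvdE)
    with less.prems have "q \<noteq> 0" by auto
    then have deg: "degree q < degree p" unfolding p by (subst degree_mult_eq) auto
    have V: "A v - z \<cdot> v \<in> V" using lin_mem[OF lin_factor[OF A]] less.prems by blast
    have "peval A p v = peval A (smult (- z) q + pCons 0 q) v"
      by (simp add: p)
    also have "\<dots> = peval A q (A v) - z \<cdot> peval A q v"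
      by (simp only: peval_add peval_smult peval_pCons) simp
    also have "\<dots> = peval A q (A v - z \<cdot> v)"
      using less.prems lin_subspaces[OF A]
      by (simp add: lin_simps[OF lin_peval] lin_mem[OF A] subspace_mem)
    finally have "peval A q (A v - z \<cdot> v) = 0" using less.prems by simp
    then obtain rs where "factors A rs (A v - z \<cdot> v) = 0"
      using less.hyps[OF deg \<open>q \<noteq> 0\<close> V] by blast
    then have "factors A (z # rs) v = 0" by simp
    then show ?thesis by blast
  qed
qed

lemma ex_peval_zero:
  assumes B: "finite B" "V \<subseteq> span B" and v: "v \<in> V"
  shows "\<exists>p. p \<noteq> 0 \<and> peval A p v = 0"
proof (cases "inj_on (\<lambda>i. (A ^^ i) v) {..card B}")
  \<comment> \<open>Linear dependence of a set does not see repetitions, so a repeated power is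
    treated separately, with the polynomial x^i - x^j.\<close>
  case False
  then obtain i j where "i \<noteq> j" and eq: "(A ^^ i) v = (A ^^ j) v" unfolding inj_on_def by blast
  have "peval A (monom 1 i + monom (- 1) j) v = 0" by (simp add: peval_add peval_monom eq)
  moreover have "monom 1 i + monom (- 1) j \<noteq> (0::'k poly)"
    using \<open>i \<noteq> j\<close> by (auto simp: poly_eq_iff coeff_monom intro!: exI[of _ i])
  ultimately show ?thesis by blast
next
  case True
  let ?S = "(\<lambda>i. (A ^^ i) v) ` {..card B}"
  have "(A ^^ i) v \<in> V" for i by (induction i) (auto simp: v lin_mem[OF A])
  then have "?S \<subseteq> span B" using B by auto
  moreover have "card ?S > card B" using True by (simp add: card_image)
  ultimately have "dependent ?S" using independent_span_bound[OF B(1), of ?S] by force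
  then obtain u where u: "\<exists>w\<in>?S. u w \<noteq> 0" "(\<Sum>w\<in>?S. u w \<cdot> w) = 0"
    unfolding dependent_finite[OF finite_imageI[OF finite_atMost]] by blast
  define p where "p = (\<Sum>i\<le>card B. monom (u ((A ^^ i) v)) i)"
  have coeff: "coeff p i = (if i \<le> card B then u ((A ^^ i) v) else 0)" for i
    unfolding p_def coeff_sum coeff_monom by simp
  have "p \<noteq> 0" using u(1) coeff by (auto simp: poly_eq_iff)
  moreover have "degree p \<le> card B" by (rule degree_le) (simp add: coeff)
  then have "peval A p v = 0"
    using u(2) by (simp add: peval_eq_sum coeff sum.reindex[OF True] o_def)
  ultimately show ?thesis by blast
qed

lemma ex_factors_zero:
  assumes B: "finite B" "span B = V"
  shows "\<exists>rs. \<forall>v\<in>V. factors A rs v = 0"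
proof -
  have "\<exists>rs. \<forall>b\<in>C. factors A rs b = 0" if "finite C" "C \<subseteq> V" for C
    using that
  proof (induction C rule: finite_induct)
    case (insert c C)
    then obtain rs where rs: "\<forall>b\<in>C. factors A rs b = 0" by blast
    obtain ss where ss: "factors A ss c = 0"
      using ex_peval_zero[OF B(1), of c] peval_zero_imp_factors_zero[of _ c] B insert.prems by blast
    have "factors A (rs @ ss) b = 0" if "b \<in> insert c C" for b
      using that rs ss insert.prems factors_commute[OF A, of b ss rs] 
      by (auto simp: factors_append lin_zero[OF lin_factors[OF A]])
    then show ?case by blast
  qed simp
  moreover have "B \<subseteq> V" using B span_superset by blast
  ultimately obtain rs where rs: "\<forall>b\<in>B. factors A rs b = 0" using B by blast
  have "V \<subseteq> {v \<in> V. factors A rs v \<in> {0}}"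
    unfolding B(2)[symmetric]
    using rs \<open>B \<subseteq> V\<close> subspace_preimage[OF lin_factors[OF A] subspace_single_0]
    by (intro span_minimal) (auto simp: B(2))
  then show ?thesis by blast
qed

lemma finite_eigs:
  assumes B: "finite B" "span B = V"
  shows "finite (eigs V A)"
  using ex_factors_zero[OF B] eigs_subset_roots[OF A] by (meson finite_set finite_subset)

lemma eigs_nonempty:
  assumes B: "finite B" "span B = V" and W: "lin W W A" "W \<subseteq> V" "W \<noteq> {0}"
  shows "eigs W A \<noteq> {}"
proof -
  obtain w where "w \<in> W" "w \<noteq> 0" using W subspace_0[OF lin_subspaces(1)[OF W(1)]] by blast
  then show ?thesis
    using ex_factors_zero[OF B] factors_zero_imp_eigenvalue[OF W(1), of w] W by blast
qed

end

text \<open>A nonzero invariant subspace of least dimension works. If an invariant \<open>U\<close>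
  were properly inside it, a basis of \<open>U\<close> together with a vector outside
  \<open>U\<close> would still be independent, so \<open>dim U\<close> would be smaller.\<close>

lemma ex_irr_subspace:
  assumes C: "finite C" "span C = V" and A: "lin V V A" and B: "lin V V B" and "V \<noteq> {0}"
  shows "\<exists>W\<subseteq>V. irr W A B"
proof -
  define I where "I W \<longleftrightarrow> subspace W \<and> W \<subseteq> V \<and> W \<noteq> {0} \<and> (\<forall>w\<in>W. A w \<in> W) \<and> (\<forall>w\<in>W. B w \<in> W)" for W
  have "I V" using assms lin_subspaces[OF A] by (auto simp: I_def lin_mem)
  then obtain W where W: "I W" and min: "\<And>U. I U \<Longrightarrow> dim W \<le> dim U"
    using ex_has_least_nat[of I V dim] by blast
  have max: "U = W" if U: "I U" and "U \<subseteq> W" for U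
  proof (rule ccontr)
    assume "U \<noteq> W"
    then obtain x where x: "x \<in> W" "x \<notin> U" using \<open>U \<subseteq> W\<close> by blast
    obtain D where D: "D \<subseteq> U" "independent D" "U \<subseteq> span D" "card D = dim U" by (rule basis_exists)
    obtain E where E: "E \<subseteq> W" "independent E" "W \<subseteq> span E" "card E = dim W" by (rule basis_exists)
    have "span D \<subseteq> U" using D U by (intro span_minimal) (auto simp: I_def)
    then have "independent (insert x D)" using x D by (intro independent_insertI) auto
    moreover have "insert x D \<subseteq> span E" using x D E \<open>U \<subseteq> W\<close> by blast
    moreover have "finite E"
      using independent_span_bound[OF C(1) E(2)] C(2) E(1) W by (auto simp: I_def)
    ultimately have "finite (insert x D) \<and> card (insert x D) \<le> card E"
      by (intro independent_span_bound)
    moreover have "x \<notin> D" using x D by blast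
    ultimately have "dim U < dim W" using D(4) E(4) by auto
    with min[OF U] show False by simp
  qed
  have "irr W A B"
    unfolding irr_def
  proof (intro conjI allI impI)
    show "W \<noteq> {0}" using W by (simp add: I_def)
    have "subspace W" "W \<subseteq> V" "\<And>w. w \<in> W \<Longrightarrow> A w \<in> W" "\<And>w. w \<in> W \<Longrightarrow> B w \<in> W"
      using W by (auto simp: I_def)
    then show "lin W W A" "lin W W B" using lin_mono[OF A] lin_mono[OF B] by blast+
    show "U = {0} \<or> U = W"
      if "subspace U" "U \<subseteq> W" "\<forall>w\<in>U. A w \<in> U" "\<forall>w\<in>U. B w \<in> U" for U
      using that W max[of U] unfolding I_def by blast
  qed
  then show ?thesis using W by (auto simp: I_def)
qed

section \<open>The Dolan--Grady relation\<close>

definition comm :: "('v \<Rightarrow> 'v) \<Rightarrow> ('v \<Rightarrow> 'v) \<Rightarrow> 'v \<Rightarrow> 'v" where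
  "comm F G v = F (G v) - G (F v)"

lemma lin_comm: "lin V V F \<Longrightarrow> lin V V G \<Longrightarrow> lin V V (comm F G)"
  using lin_sub[OF lin_comp[of V V F V G] lin_comp[of V V G V F]] by (simp add: comm_def[abs_def])

text \<open>One relation with two uses: in both orders it presents the Onsager algebra, and it is
  the relation between opposite generators of the tetrahedron algebra.\<close>

definition dolan_grady :: "'v set \<Rightarrow> ('v \<Rightarrow> 'v) \<Rightarrow> ('v \<Rightarrow> 'v) \<Rightarrow> bool" where
  "dolan_grady V A B \<longleftrightarrow> (\<forall>v\<in>V. comm A (comm A (comm A B)) v = 4 \<cdot> comm A B v)"

text \<open>On an eigenvector for \<open>c\<close>, a commutator with \<open>A\<close> amounts to
  applying L = A - c. The relation becomes L^3 (B v) = 4 L (B v), so L (L - 2) (L + 2) kills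
  \<open>B v\<close>, and \<open>B v\<close> splits into eigenvectors of L for 0, 2 and -2.\<close>

lemma dolan_grady_eigenvector:
  assumes A: "lin V V A" and B: "lin V V B" and dg: "dolan_grady V A B"
    and v: "v \<in> V" "A v = c \<cdot> v"
  shows "B v \<in> esum V A {c, c + 2, c - 2}"
proof -
  note V = lin_subspaces(1)[OF A]
  let ?E = "esum V A {c, c + 2, c - 2}"
  define L where "L u = A u - c \<cdot> u" for u
  have L: "lin V V L" unfolding L_def[abs_def] by (rule lin_factor[OF A])
  have AL: "A u = L u + c \<cdot> u" for u by (simp add: L_def)
  have comm: "comm A F v = L (F v)" if "lin V V F" for F
    using lin_scale[OF that v(1), of c] v(2) by (simp add: comm_def L_def)
  define x y where "x = L (B v)" and "y = L x"
  have Ly: "L y = 4 \<cdot> x"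
    using dg v(1) comm[OF B] comm[OF lin_comm[OF A B]] comm[OF lin_comm[OF A lin_comm[OF A B]]]
    by (simp add: dolan_grady_def x_def y_def)
  have mem: "B v \<in> V" "x \<in> V" "y \<in> V"
    using v by (simp_all add: x_def y_def lin_mem[OF B] lin_mem[OF L])
  note * = lin_simps[OF L] mem V subspace_mem
  \<comment> \<open>Up to scalars these are the three components of \<open>B v\<close>, obtained by
    interpolation at 0, 2, -2 from x = L (B v) and y = L x, using L y = 4 x.\<close>
  have "B v - (1/4) \<cdot> y \<in> ?E"
    by (rule esum_base[of _ _ c]) (simp_all add: AL * Ly flip: x_def)
  moreover have "y + 2 \<cdot> x \<in> ?E"
    by (rule esum_base[of _ _ "c + 2"])
      (simp_all add: AL * Ly scale_left_distrib scale_right_distrib mult.commute flip: y_def)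
  moreover have "y - 2 \<cdot> x \<in> ?E"
    by (rule esum_base[of _ _ "c - 2"])
      (simp_all add: AL * Ly scale_left_distrib scale_right_distrib scale_left_diff_distrib
        scale_right_diff_distrib mult.commute flip: y_def)
  ultimately have "(B v - (1/4) \<cdot> y) + ((1/8) \<cdot> (y + 2 \<cdot> x) + (1/8) \<cdot> (y - 2 \<cdot> x)) \<in> ?E"
    by (metis subspace_add[OF subspace_esum] subspace_scale[OF subspace_esum])
  moreover have "(1/8) \<cdot> (y + 2 \<cdot> x) + (1/8) \<cdot> (y - 2 \<cdot> x) = (1/4) \<cdot> y"
    by (simp add: scale_right_distrib scale_right_diff_distrib flip: scale_left_distrib)
  ultimately show ?thesis by simp
qed

text \<open>\<open>B\<close> moves an eigenvalue by 0, 2 or -2, and a component outside the spectrum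
  is zero. So \<open>T\<close> has to contain only the neighbours that are eigenvalues.\<close>

lemma dolan_grady_esum:
  assumes A: "lin V V A" and B: "lin V V B" and dg: "dolan_grady V A B"
    and T: "\<And>s t. s \<in> S \<Longrightarrow> t \<in> eigs V A \<Longrightarrow> t \<in> {s, s + 2, s - 2} \<Longrightarrow> t \<in> T"
    and v: "v \<in> esum V A S"
  shows "B v \<in> esum V A T"
proof (rule esum_map[OF B subspace_esum _ v])
  fix u s assume "u \<in> V" "s \<in> S" "A u = s \<cdot> u"
  then have "B u \<in> esum V A ({s, s + 2, s - 2} \<inter> eigs V A)"
    using dolan_grady_eigenvector[OF A B dg] esum_eigs by blast
  also have "\<dots> \<subseteq> esum V A T" using T \<open>s \<in> S\<close> by (intro esum_mono) auto
  finally show "B u \<in> esum V A T" .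
qed

text \<open>This is the source of diagonalizability: a set of eigenvalues closed under steps of 2
  inside the spectrum spans a submodule, which is nonzero because of \<open>c\<close>.\<close>

lemma irr_esum:
  assumes irr: "irr V A B" and dg: "dolan_grady V A B"
    and "c \<in> S" "c \<in> eigs V A"
    and closed: "\<And>s t. s \<in> S \<Longrightarrow> t \<in> eigs V A \<Longrightarrow> t = s + 2 \<or> t = s - 2 \<Longrightarrow> t \<in> S"
  shows "esum V A S = V"
proof -
  note A = irrD(2)[OF irr] and B = irrD(3)[OF irr]
  have "esum V A S = {0} \<or> esum V A S = V"
  proof (rule irrD(4)[OF irr subspace_esum])
    show "esum V A S \<subseteq> V" by (rule esum_subset[OF lin_subspaces(1)[OF A]])
    show "A w \<in> esum V A S" if "w \<in> esum V A S" for w by (rule esum_invariant[OF A that])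
    show "B w \<in> esum V A S" if "w \<in> esum V A S" for w
      by (rule dolan_grady_esum[OF A B dg _ that]) (use closed in blast)
  qed
  moreover obtain v where "v \<in> V" "v \<noteq> 0" "A v = c \<cdot> v" using \<open>c \<in> eigs V A\<close> unfolding eigs_def by blast
  then have "esum V A S \<noteq> {0}" using esum_base[of v V c S A] \<open>c \<in> S\<close> by auto
  ultimately show ?thesis by blast
qed

text \<open>In characteristic 0 a finite spectrum contains no infinite progression. So there is an
  eigenvalue \<open>a\<close> with \<open>a + 2\<close> missing, and the maximal run downwards from
  \<open>a\<close> is closed under steps of 2; by \<open>irr_esum\<close> it is the whole
  spectrum.\<close>

lemma irr_eigs_string:
  assumes irr: "irr V A B" and dg: "dolan_grady V A B"
    and fin: "finite (eigs V A)" and ne: "eigs V A \<noteq> {}"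
  shows "\<exists>a m. eigs V A = {a - 2 * of_nat i | i. i \<le> m}"
proof -
  have inf: "\<not> (\<forall>n::nat. c + e * of_nat n \<in> eigs V A)" if "e \<noteq> 0" for c e
  proof
    assume "\<forall>n::nat. c + e * of_nat n \<in> eigs V A"
    then have "finite (range (\<lambda>n. c + e * of_nat n))" using fin by (auto intro: finite_subset)
    then show False using finite_imageD[of "\<lambda>n. c + e * of_nat n" UNIV] that by (auto simp: inj_on_def)
  qed
  obtain c where "c \<in> eigs V A" using ne by blast
  have "\<exists>a\<in>eigs V A. a + 2 \<notin> eigs V A"
  proof (rule ccontr)
    assume *: "\<not> ?thesis"
    have "c + 2 * of_nat n \<in> eigs V A" for n
    proof (induction n)
      case (Suc n)
      then have "(c + 2 * of_nat n) + 2 \<in> eigs V A" using * by blast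
      then show ?case by (simp add: algebra_simps)
    qed (use \<open>c \<in> eigs V A\<close> in simp)
    then show False using inf[of 2 c] by simp
  qed
  then obtain a where a: "a \<in> eigs V A" "a + 2 \<notin> eigs V A" by blast
  have "\<exists>n. a - 2 * of_nat n \<notin> eigs V A" using inf[of "-2" a] by simp
  then obtain n where n: "a - 2 * of_nat n \<notin> eigs V A" "\<And>i. i < n \<Longrightarrow> a - 2 * of_nat i \<in> eigs V A"
    using exists_least_iff[of "\<lambda>n. a - 2 * of_nat n \<notin> eigs V A"] by blast
  then obtain m where m: "n = Suc m" using a by (cases n) auto
  let ?S = "(\<lambda>i. a - 2 * of_nat i) ` {..m}"
  have "esum V A ?S = V"
  proof (rule irr_esum[OF irr dg _ a(1)])
    show "a \<in> ?S" by (rule image_eqI[of _ _ 0]) auto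
    fix s t assume "s \<in> ?S" and t: "t \<in> eigs V A" and st: "t = s + 2 \<or> t = s - 2"
    then obtain i where i: "s = a - 2 * of_nat i" "i \<le> m" by auto
    from st show "t \<in> ?S"
    proof
      assume eq: "t = s + 2"
      have "i \<noteq> 0"
      proof
        assume "i = 0"
        with a(2) t i eq show False by simp
      qed
      then show ?thesis using i eq by (intro image_eqI[of _ _ "i - 1"]) (auto simp: of_nat_diff)
    next
      assume eq: "t = s - 2"
      have "i \<noteq> m" using n(1) t i eq m by (auto simp: algebra_simps)
      then show ?thesis using i eq by (intro image_eqI[of _ _ "Suc i"]) (auto simp: algebra_simps)
    qed
  qed
  then have "eigs V A \<subseteq> ?S" by (intro esum_eq_imp_eigs_subset irrD(2)[OF irr]) auto
  moreover have "?S \<subseteq> eigs V A" using n(2) m by auto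
  ultimately have "eigs V A = {a - 2 * of_nat i | i. i \<le> m}" by auto
  then show ?thesis by blast
qed


section \<open>Adjacent generators\<close>

definition adj :: "'v set \<Rightarrow> ('v \<Rightarrow> 'v) \<Rightarrow> ('v \<Rightarrow> 'v) \<Rightarrow> bool" where
  "adj V F G \<longleftrightarrow> lin V V F \<and> lin V V G \<and> (\<forall>v\<in>V. comm F G v = 2 \<cdot> F v + 2 \<cdot> G v)"

lemma adjD:
  assumes "adj V F G"
  shows "lin V V F" "lin V V G"
    and "v \<in> V \<Longrightarrow> F (G v) = G (F v) + 2 \<cdot> F v + 2 \<cdot> G v"
  using assms by (simp_all add: adj_def comm_def diff_eq_eq add_ac)

text \<open>Reading a path backwards: if \<open>F\<close> and \<open>G\<close> are the generators
  for rs and st, then \<open>neg G\<close> and \<open>neg F\<close> are those for ts and sr.\<close>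

lemma adj_neg: "adj V F G \<Longrightarrow> adj V (neg G) (neg F)"
  unfolding adj_def by (auto simp: lin_neg comm_def lin_minus lin_mem algebra_simps)

text \<open>If A x = c x, then A (P x + c x) = (c + e) (P x + c x). So the successive factors P + (a
  + e j) move an eigenvector along the progression a, a + e, a + 2e, ..., and finiteness of the
  spectrum forces the product to vanish.\<close>

lemma factors_string_zero:
  assumes A: "lin V V A" and P: "lin V V P" and fin: "finite (eigs V A)" and "e \<noteq> 0"
    and AP: "\<And>v. v \<in> V \<Longrightarrow> A (P v) = P (A v) + e \<cdot> (A v + P v)"
    and v: "v \<in> V" "A v = a \<cdot> v"
  shows "\<exists>k. factors P (map (\<lambda>j. - (a + e * of_nat j)) [0..<k]) v = 0"
proof (rule ccontr)
  assume nz: "\<not> ?thesis"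
  define x where "x k = factors P (map (\<lambda>j. - (a + e * of_nat j)) [0..<k]) v" for k
  have x_Suc: "x (Suc k) = P (x k) + (a + e * of_nat k) \<cdot> x k" for k
    unfolding x_def by (simp add: factors_append scale_left_diff_distrib scale_left_distrib)
  have x_mem: "x k \<in> V" for k unfolding x_def by (rule lin_mem[OF lin_factors[OF P] v(1)])
  have "A (x k) = (a + e * of_nat k) \<cdot> x k" for k
  proof (induction k)
    case 0
    then show ?case by (simp add: x_def v)
  next
    case (Suc k)
    define c where "c = a + e * of_nat k"
    have IH: "A (x k) = c \<cdot> x k" using Suc by (simp add: c_def)
    have "A (x (Suc k)) = A (P (x k)) + c \<cdot> A (x k)"
      unfolding x_Suc c_def[symmetric] using x_mem[of k] lin_subspaces[OF A]
      by (simp add: lin_simps[OF A] lin_mem[OF P] subspace_scale)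
    also have "\<dots> = c \<cdot> P (x k) + e \<cdot> (c \<cdot> x k + P (x k)) + c \<cdot> c \<cdot> x k"
      using x_mem[of k] by (simp add: AP IH lin_scale[OF P])
    also have "\<dots> = (c + e) \<cdot> x (Suc k)"
      unfolding x_Suc c_def[symmetric]
      by (simp add: scale_left_distrib scale_right_distrib distrib_left mult.commute)
    finally show ?case by (simp add: c_def algebra_simps)
  qed
  moreover have "x k \<noteq> 0" for k using nz unfolding x_def by blast
  ultimately have "a + e * of_nat k \<in> eigs V A" for k using x_mem unfolding eigs_def by blast
  then have "finite (range (\<lambda>k::nat. a + e * of_nat k))" using fin by (auto intro: finite_subset)
  then show False
    using finite_imageD[of "\<lambda>k::nat. a + e * of_nat k" UNIV] \<open>e \<noteq> 0\<close> by (auto simp: inj_on_def)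
qed

text \<open>
  If \<open>A v = a v\<close>, then \<open>P\<close> satisfies on \<open>v\<close> a polynomial with roots in \<open>-a - 2\<nat>\<close>; if \<open>v\<close> is a sum
  of eigenvectors of \<open>B\<close> with eigenvalues in \<open>b - 2\<nat>\<close>, also one with roots in \<open>-b + 2\<nat>\<close>.
\<close>

lemma adj_eigenvalue_le:
  assumes AP: "adj V A P" and PB: "adj V P B"
    and fin: "finite (eigs V A)" "finite (eigs V B)"
    and v: "v \<in> V" "v \<noteq> 0" "A v = a \<cdot> v" "v \<in> esum V B {b - 2 * of_nat i | i. True}"
  shows "\<exists>n. b - a = 2 * of_nat n"
proof -
  note A = adjD(1)[OF AP] and P = adjD(1)[OF PB] and B = adjD(2)[OF PB]
  obtain k where k: "factors P (map (\<lambda>j. - (a + 2 * of_nat j)) [0..<k]) v = 0"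
    using factors_string_zero[OF A P fin(1), of 2 v a] v adjD(3)[OF AP]
    by (auto simp: scale_right_distrib add.assoc)
  let ?R = "{- b + 2 * of_nat j | j. True}"
  let ?U = "{w \<in> V. \<exists>rs. set rs \<subseteq> ?R \<and> factors P rs w = 0}"
  have "esum V B {b - 2 * of_nat i | i. True} \<subseteq> ?U"
  proof (rule esum_least)
    note V = lin_subspaces(1)[OF P]
    show "subspace ?U"
    proof (rule subspaceI)
      show "0 \<in> ?U" using subspace_0[OF V] by (auto intro!: exI[of _ "[]"])
      fix x y assume "x \<in> ?U" "y \<in> ?U"
      then obtain rs ss where *: "x \<in> V" "y \<in> V" "set rs \<subseteq> ?R" "set ss \<subseteq> ?R"
        "factors P rs x = 0" "factors P ss y = 0" by blast
      have "factors P (rs @ ss) (x + y) = 0"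
        using * factors_commute[OF P, of y ss rs]
        by (simp add: factors_append lin_add[OF lin_factors[OF P]] lin_zero[OF lin_factors[OF P]])
      then show "x + y \<in> ?U" using * subspace_add[OF V] by (auto intro!: exI[of _ "rs @ ss"])
    next
      fix c x assume "x \<in> ?U"
      then show "c \<cdot> x \<in> ?U" using subspace_scale[OF V] by (auto simp: lin_scale[OF lin_factors[OF P]])
    qed
    fix w c assume w: "w \<in> V" "c \<in> {b - 2 * of_nat i | i. True}" "B w = c \<cdot> w"
    then obtain i :: nat where i: "c = b - 2 * of_nat i" by blast
    have "B (P u) = P (B u) + (- 2) \<cdot> (B u + P u)" if "u \<in> V" for u
      using adjD(3)[OF PB that] by (simp add: scale_right_distrib)
    then obtain l where l: "factors P (map (\<lambda>j. - (c + - 2 * of_nat j)) [0..<l]) w = 0"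
      using factors_string_zero[OF B P fin(2), of "-2" w c] w by auto
    have "set (map (\<lambda>j. - (c + - 2 * of_nat j)) [0..<l]) \<subseteq> ?R"
    proof clarsimp
      fix j
      have "2 * of_nat j - c = 2 * of_nat (i + j) - b" by (simp add: i algebra_simps)
      then show "\<exists>ja. 2 * of_nat j - c = 2 * of_nat ja - b" ..
    qed
    then show "w \<in> ?U" using w l by blast
  qed
  then obtain rs where rs: "set rs \<subseteq> ?R" "factors P rs v = 0" using v(4) by blast
  \<comment> \<open>Since \<open>v\<close> is nonzero, the two polynomials share a root -a - 2i = -b
    + 2j, which gives b - a = 2 (i + j).\<close>
  have "set (map (\<lambda>j. - (a + 2 * of_nat j)) [0..<k]) \<inter> set rs \<noteq> {}"
    using factors_coprime[OF P v(1) k rs(2)] v(2) by blast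
  then obtain x where x: "x \<in> set (map (\<lambda>j. - (a + 2 * of_nat j)) [0..<k])" "x \<in> ?R"
    using rs(1) by blast
  then obtain i j :: nat where "- (a + 2 * of_nat i) = - b + 2 * of_nat j" by auto
  then have "b - a = 2 * of_nat (i + j)" by (simp add: algebra_simps)
  then show ?thesis ..
qed


section \<open>The split decomposition\<close>

lemma ex_direct_sum_operator:
  fixes U :: "nat \<Rightarrow> 'v set"
  assumes U: "\<And>i. subspace (U i)" "\<And>i. U i \<subseteq> V" and V: "subspace V" "V \<subseteq> span (\<Union>i\<le>d. U i)"
    and indep: "\<And>u i. (\<And>i. i \<le> d \<Longrightarrow> u i \<in> U i) \<Longrightarrow> (\<Sum>i\<le>d. u i) = 0 \<Longrightarrow> i \<le> d \<Longrightarrow> u i = 0"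
  shows "\<exists>P. lin V V P \<and> (\<forall>i\<le>d. \<forall>v\<in>U i. P v = m i \<cdot> v)"
proof -
  define D where "D v u \<longleftrightarrow> (\<forall>i\<le>d. u i \<in> U i) \<and> v = (\<Sum>i\<le>d. u i)" for v u
  have D_add: "D (v + w) (\<lambda>i. u i + u' i)" if "D v u" "D w u'" for v w u u'
    using that by (auto simp: D_def sum.distrib subspace_add[OF U(1)])
  have D_diff: "D (v - w) (\<lambda>i. u i - u' i)" if "D v u" "D w u'" for v w u u'
    using that by (auto simp: D_def sum_subtractf subspace_diff[OF U(1)])
  have D_scale: "D (c \<cdot> v) (\<lambda>i. c \<cdot> u i)" if "D v u" for c v u
    using that by (auto simp: D_def scale_sum_right subspace_scale[OF U(1)])
  have D_single: "D v (\<lambda>j. if j = i then v else 0)" if "i \<le> d" "v \<in> U i" for v i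
    using that by (auto simp: D_def subspace_0[OF U(1)])
  have "V \<subseteq> {v. \<exists>u. D v u}"
  proof (rule subset_trans[OF V(2)], rule span_minimal)
    show "(\<Union>i\<le>d. U i) \<subseteq> {v. \<exists>u. D v u}" using D_single by blast
    have "D 0 (\<lambda>_. 0)" by (simp add: D_def subspace_0[OF U(1)])
    then show "subspace {v. \<exists>u. D v u}"
      using D_add D_scale unfolding subspace_def by blast
  qed
  then have ex: "\<exists>u. D v u" if "v \<in> V" for v using that by blast
  \<comment> \<open>The components beyond \<open>d\<close> are arbitrary, but those up to
    \<open>d\<close> are unique by \<open>indep\<close>, so the choice does not affect the
    sum.\<close>
  define P where "P v = (\<Sum>i\<le>d. m i \<cdot> (SOME u. D v u) i)" for v
  have P: "P v = (\<Sum>i\<le>d. m i \<cdot> u i)" if "D v u" for v u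
  proof -
    let ?u = "SOME u. D v u"
    have "D v ?u" using someI[of "D v", OF that] .
    then have *: "D (v - v) (\<lambda>i. ?u i - u i)" using that by (rule D_diff)
    have "?u i - u i = 0" if "i \<le> d" for i
      by (rule indep[OF _ _ that]) (use * in \<open>auto simp: D_def\<close>)
    then show ?thesis unfolding P_def by (intro sum.cong) auto
  qed
  have "lin V V P"
  proof (rule linI[OF V(1) V(1)])
    fix v assume "v \<in> V"
    then obtain u where u: "D v u" using ex by blast
    then show "P v \<in> V" unfolding P[OF u]
      using U(2) by (intro subspace_sum[OF V(1)] subspace_scale[OF V(1)]) (auto simp: D_def)
    show "P (c \<cdot> v) = c \<cdot> P v" for c
      by (simp add: P[OF u] P[OF D_scale[OF u]] scale_sum_right mult.commute)
    fix w assume "w \<in> V"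
    then obtain u' where u': "D w u'" using ex by blast
    show "P (v + w) = P v + P w"
      by (simp add: P[OF u] P[OF u'] P[OF D_add[OF u u']] scale_right_distrib sum.distrib)
  qed
  moreover have "P v = m i \<cdot> v" if "i \<le> d" "v \<in> U i" for v i
  proof -
    have "P v = (\<Sum>j\<le>d. if j = i then m i \<cdot> v else 0)"
      unfolding P[OF D_single[OF that]] by (intro sum.cong) auto
    then show ?thesis using that by simp
  qed
  ultimately show ?thesis by blast
qed

text \<open>The spectrum of both generators on a module of type (0, 0) and diameter
  \<open>d\<close>.\<close>

definition weights :: "nat \<Rightarrow> 'k set" where
  "weights d = {of_nat d - 2 * of_nat i | i. i \<le> d}"

lemma of_nat_mem_weights: "of_nat d \<in> weights d"
  unfolding weights_def by (auto intro!: exI[of _ 0])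

text \<open>Characteristic 0 turns these into statements about natural numbers. They say that a
  shift outwards by 2 or 4 sends an extremal eigenvalue out of the spectrum.\<close>

lemma of_nat_add_even_notin_weights:
  assumes "n > 0"
  shows "of_nat d + 2 * of_nat n \<notin> weights d" "- of_nat d - 2 * of_nat n \<notin> weights d"
proof -
  have False if "of_nat d + 2 * of_nat n = (of_nat d - 2 * of_nat i :: 'k)" for i
  proof -
    have "of_nat (2 * n + 2 * i) = (0 :: 'k)" using that by (simp add: algebra_simps)
    with assms show False by (simp only: of_nat_eq_0_iff)
  qed
  then show "of_nat d + 2 * of_nat n \<notin> weights d" unfolding weights_def by blast
  have False if "- of_nat d - 2 * of_nat n = (of_nat d - 2 * of_nat i :: 'k)" "i \<le> d" for i
  proof -
    have "of_nat (2 * i) = (of_nat (2 * d + 2 * n) :: 'k)" using that by (simp add: algebra_simps)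
    with assms that(2) show False by (simp only: of_nat_eq_iff)
  qed
  then show "- of_nat d - 2 * of_nat n \<notin> weights d" unfolding weights_def by blast
qed

lemma uminus_weights: "uminus ` weights d = weights d"
proof -
  have "- c \<in> weights d" if c: "c \<in> weights d" for c
  proof -
    obtain i :: nat where i: "c = of_nat d - 2 * of_nat i" "i \<le> d" using c unfolding weights_def by blast
    then have "- c = of_nat d - 2 * of_nat (d - i)" by (simp add: of_nat_diff algebra_simps)
    then show ?thesis unfolding weights_def by (auto intro!: exI[of _ "d - i"])
  qed
  then show ?thesis by (auto simp: mem_uminus_image_iff)
qed

text \<open>
  With \<open>F i\<close> (resp. \<open>G i\<close>) the sum of the eigenspaces of \<open>A\<close> (resp. \<open>B\<close>) for the eigenvalues
  \<open>d - 2j\<close> with \<open>j < i\<close> (resp. \<open>j \<ge> i\<close>), the sum of the \<open>F i \<inter> G i\<close> is a proper submodule, hence zero,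
  while the sum of the \<open>F (i + 1) \<inter> G i\<close> is a nonzero submodule, hence everything. So \<open>V\<close> is the
  direct sum of the latter, and \<open>P\<close> acts on the \<open>i\<close>-th summand as \<open>-(d - 2i)\<close>.
\<close>

lemma ex_adj_between:
  assumes irr: "irr V A B" and AB: "dolan_grady V A B" and BA: "dolan_grady V B A"
    and eA: "eigs V A = weights d" and eB: "eigs V B = weights d"
  shows "\<exists>P. adj V A P \<and> adj V P B"
proof -
  note A = irrD(2)[OF irr] and B = irrD(3)[OF irr]
  note V = lin_subspaces(1)[OF A]
  define t :: "nat \<Rightarrow> 'k" where "t i = of_nat d - 2 * of_nat i" for i
  have t_eq: "t i = t j + 2 \<longleftrightarrow> j = Suc i" "t i = t j - 2 \<longleftrightarrow> i = Suc j" "t i = t j \<longleftrightarrow> i = j" for i j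
  proof -
    have "t i = t j + 2 \<longleftrightarrow> (of_nat (2 * j) :: 'k) = of_nat (2 * Suc i)"
      unfolding t_def by (auto simp: algebra_simps)
    then show "t i = t j + 2 \<longleftrightarrow> j = Suc i" unfolding of_nat_eq_iff by arith
    have "t i = t j - 2 \<longleftrightarrow> (of_nat (2 * i) :: 'k) = of_nat (2 * Suc j)"
      unfolding t_def by (auto simp: algebra_simps)
    then show "t i = t j - 2 \<longleftrightarrow> i = Suc j" unfolding of_nat_eq_iff by arith
  qed (simp add: t_def)
  have w: "weights d = t ` {..d}" unfolding weights_def t_def by auto
  define F where "F i = esum V A (t ` {..<i})" for i
  define G where "G i = esum V B (t ` {i..d})" for i
  have sub: "subspace (F i)" "subspace (G i)" "F i \<subseteq> V" "G i \<subseteq> V" for i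
    unfolding F_def G_def using subspace_esum esum_subset[OF V] by auto
  have F_mono: "F i \<subseteq> F j" and G_mono: "G j \<subseteq> G i" if "i \<le> j" for i j
    unfolding F_def G_def by (intro esum_mono image_mono; use that in auto)+
  have F0: "F 0 = {0}" and G_top: "i > d \<Longrightarrow> G i = {0}" for i
    by (simp_all add: F_def G_def esum_empty)
  have top: "t 0 \<in> t ` {..d}" by auto
  have F_top: "F (Suc d) = V"
    unfolding F_def lessThan_Suc_atMost using eA w
    by (intro irr_esum[OF irr AB top]) auto
  have G0: "G 0 = V"
    unfolding G_def atLeast0AtMost using eB w
    by (intro irr_esum[OF irr_swap[OF irr] BA top]) auto
  \<comment> \<open>On the flag \<open>F\<close>, \<open>A - t i\<close> goes down one step and
    \<open>B\<close> goes up at most one; on \<open>G\<close> the roles are exchanged. So on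
    intersections of the two flags \<open>A\<close> lowers and \<open>B\<close> raises the index, up
    to scalars.\<close>
  have AF: "A v - t i \<cdot> v \<in> F i" if "v \<in> F (Suc i)" for v i
    using esum_shift[OF A, of v "t i" "t ` {..<i}"] that by (simp add: F_def lessThan_Suc)
  have BF: "B v \<in> F (Suc i)" if "v \<in> F i" for v i
    using that unfolding F_def
  proof (rule dolan_grady_esum[OF A B AB, rotated])
    fix s x assume "s \<in> t ` {..<i}" "x \<in> eigs V A" "x \<in> {s, s + 2, s - 2}"
    then show "x \<in> t ` {..<Suc i}" unfolding eA w by (auto simp: t_eq)
  qed
  have BG: "B v - t i \<cdot> v \<in> G (Suc i)" if "v \<in> G i" "i \<le> d" for v i
    using esum_shift[OF B, of v "t i" "t ` {Suc i..d}"] that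
    by (simp add: G_def flip: image_insert atLeastAtMost_insertL)
  have AG: "A v \<in> G i" if "v \<in> G (Suc i)" for v i
    using that unfolding G_def
  proof (rule dolan_grady_esum[OF B A BA, rotated])
    fix s x assume "s \<in> t ` {Suc i..d}" "x \<in> eigs V B" "x \<in> {s, s + 2, s - 2}"
    then show "x \<in> t ` {i..d}" unfolding eB w by (auto simp: t_eq)
  qed
  have AF': "A v \<in> F i" if "v \<in> F i" for v i
    using esum_invariant[OF A] that unfolding F_def by blast
  have BG': "B v \<in> G i" if "v \<in> G i" for v i
    using esum_invariant[OF B] that unfolding G_def by blast

  \<comment> \<open>Stated for a general family because it serves both families of
    intersections.\<close>
  have span_cases: "span (\<Union> (range X)) = {0} \<or> span (\<Union> (range X)) = V"
    if X: "\<And>i. X i \<subseteq> V" "\<And>i v. v \<in> X i \<Longrightarrow> A v \<in> span (\<Union> (range X))"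
      "\<And>i v. v \<in> X i \<Longrightarrow> B v \<in> span (\<Union> (range X))" for X :: "nat \<Rightarrow> 'v set"
  proof (rule irrD(4)[OF irr])
    let ?S = "span (\<Union> (range X))"
    show "subspace ?S" by simp
    show sV: "?S \<subseteq> V" using X(1) by (intro span_minimal V) auto
    have "?S \<subseteq> {v \<in> V. A v \<in> ?S}"
      using X by (intro span_minimal subspace_preimage[OF A]) auto
    then show "A v \<in> ?S" if "v \<in> ?S" for v using that by blast
    have "?S \<subseteq> {v \<in> V. B v \<in> ?S}"
      using X by (intro span_minimal subspace_preimage[OF B]) auto
    then show "B v \<in> ?S" if "v \<in> ?S" for v using that by blast
  qed

  define X where "X i = F i \<inter> G i" for i
  have X0: "X i = {0}" for i
  proof -
    let ?S = "span (\<Union> (range X))"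
    have X_S: "v \<in> ?S" if "v \<in> X i" for v i using that by (blast intro: span_base)
    have "?S = {0} \<or> ?S = V"
    proof (rule span_cases)
      show "X i \<subseteq> V" for i using sub by (auto simp: X_def)
      fix i v assume v: "v \<in> X i"
      show "A v \<in> ?S"
      proof (cases i)
        case 0
        then show ?thesis using v F0 by (simp add: X_def lin_zero[OF A] span_zero)
      next
        case (Suc j)
        then have "v \<in> G j" using v G_mono[of j i] by (auto simp: X_def)
        then have "A v - t j \<cdot> v \<in> X j"
          using v Suc AF AG sub by (auto simp: X_def intro!: subspace_diff subspace_scale)
        then have "(A v - t j \<cdot> v) + t j \<cdot> v \<in> ?S" by (intro span_add span_scale X_S[OF v] X_S)
        then show ?thesis by simp
      qed
      show "B v \<in> ?S"
      proof (cases "i \<le> d")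
        case True
        have "v \<in> F (Suc i)" using v F_mono[of i "Suc i"] by (auto simp: X_def)
        then have "B v - t i \<cdot> v \<in> X (Suc i)"
          using v BF BG True sub by (auto simp: X_def intro!: subspace_diff subspace_scale)
        then have "(B v - t i \<cdot> v) + t i \<cdot> v \<in> ?S" by (intro span_add span_scale X_S[OF v] X_S)
        then show ?thesis by simp
      next
        case False
        then show ?thesis using v G_top[of i] by (simp add: X_def lin_zero[OF B] span_zero)
      qed
    qed
    \<comment> \<open>Every \<open>X i\<close> lies in \<open>F d\<close>, because
      \<open>G i\<close> vanishes for \<open>i > d\<close>; and \<open>F d\<close> misses the
      eigenvalue \<open>t d\<close>.\<close>
    moreover have "?S \<noteq> V"
    proof
      assume "?S = V"
      moreover have "X i \<subseteq> F d" for i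
        using F_mono[of i d] G_top[of i] subspace_0[OF sub(1)] by (cases "i \<le> d") (auto simp: X_def)
      then have "?S \<subseteq> F d" by (intro span_minimal sub) auto
      ultimately have "esum V A (t ` {..<d}) = V" using sub(3)[of d] by (simp add: F_def)
      then have "eigs V A \<subseteq> t ` {..<d}" by (intro esum_eq_imp_eigs_subset[OF A]) auto
      moreover have "t d \<in> eigs V A" unfolding eA w by simp
      ultimately show False by (auto simp: t_eq)
    qed
    ultimately have "?S = {0}" by blast
    then have "X i \<subseteq> {0}" using X_S by blast
    then show ?thesis using subspace_0[OF sub(1)] subspace_0[OF sub(2)] by (auto simp: X_def)
  qed

  define U where "U i = F (Suc i) \<inter> G i" for i
  have U_sub: "subspace (U i)" "U i \<subseteq> V" for i
    unfolding U_def using sub subspace_inter by auto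
  \<comment> \<open>For \<open>i = 0\<close> truncated subtraction yields \<open>U 0\<close> again.
    This is harmless because the vector is then zero, which \<open>AU0\<close> records for the later
    computation of \<open>P\<close> on it.\<close>
  have AU: "A v - t i \<cdot> v \<in> U (i - 1)" and AU0: "i = 0 \<Longrightarrow> A v - t i \<cdot> v = 0" if "v \<in> U i" for v i
  proof -
    have *: "A v - t i \<cdot> v \<in> F i" using that AF by (auto simp: U_def)
    then show 0: "A v - t i \<cdot> v = 0" if "i = 0" using that F0 by auto
    show "A v - t i \<cdot> v \<in> U (i - 1)"
    proof (cases i)
      case 0
      then show ?thesis using * F0 U_sub subspace_0 by auto
    next
      case (Suc j)
      then have "v \<in> G j" using that G_mono[of j i] by (auto simp: U_def)
      then show ?thesis
        using that * Suc AG sub by (auto simp: U_def intro!: subspace_diff subspace_scale)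
    qed
  qed
  have BU: "B v - t i \<cdot> v \<in> U (Suc i)" if "v \<in> U i" "i \<le> d" for v i
  proof -
    have "v \<in> F (Suc (Suc i))" using that F_mono[of "Suc i" "Suc (Suc i)"] by (auto simp: U_def)
    then show ?thesis
      using that BG[of v i] BF sub by (auto simp: U_def intro!: subspace_diff subspace_scale)
  qed
  have U_top: "U i = {0}" if "i > d" for i
    using G_top[OF that] subspace_0[OF sub(1)] by (auto simp: U_def)
  have U_span: "span (\<Union> (range U)) = V"
  proof -
    let ?S = "span (\<Union> (range U))"
    have U_S: "v \<in> ?S" if "v \<in> U i" for v i using that by (blast intro: span_base)
    have "?S = {0} \<or> ?S = V"
    proof (rule span_cases)
      fix i v assume v: "v \<in> U i"
      have "(A v - t i \<cdot> v) + t i \<cdot> v \<in> ?S" by (intro span_add span_scale U_S[OF v] U_S[OF AU[OF v]])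
      then show "A v \<in> ?S" by simp
      show "B v \<in> ?S"
      proof (cases "i \<le> d")
        case True
        then have "(B v - t i \<cdot> v) + t i \<cdot> v \<in> ?S" by (intro span_add span_scale U_S[OF v] U_S[OF BU[OF v]])
        then show ?thesis by simp
      next
        case False
        then show ?thesis using v U_top[of i] by (simp add: lin_zero[OF B] span_zero)
      qed
    qed (use U_sub in auto)
    moreover obtain v where v: "v \<in> V" "v \<noteq> 0" "A v = t 0 \<cdot> v"
      using eA w top unfolding eigs_def by blast
    then have "v \<in> U 0"
      unfolding U_def F_def G0 by (auto intro: esum_base)
    ultimately show ?thesis using U_S v(2) by blast
  qed
  have "\<Union> (range U) \<subseteq> span (\<Union>i\<le>d. U i)"
  proof clarify
    fix i v assume "v \<in> U i"
    then show "v \<in> span (\<Union>i\<le>d. U i)"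
      using U_top[of i] by (cases "i \<le> d") (auto simp: span_zero intro: span_base)
  qed
  then have V_span: "V \<subseteq> span (\<Union>i\<le>d. U i)"
    unfolding U_span[symmetric] by (rule span_minimal) simp
  \<comment> \<open>Once the earlier terms vanish, \<open>u i\<close> is minus the sum of the later
    ones. So it lies in \<open>G (Suc i)\<close> as well as in \<open>F (Suc i)\<close>, whose
    intersection is zero.\<close>
  have indep: "u i = 0"
    if u: "\<And>i. i \<le> d \<Longrightarrow> u i \<in> U i" and sum: "(\<Sum>i\<le>d. u i) = 0" and "i \<le> d" for u i
    using \<open>i \<le> d\<close>
  proof (induction i rule: less_induct)
    case (less i)
    have "(\<Sum>j\<le>d. u j) = (\<Sum>j\<in>{i..d}. u j)"
      by (rule sum.mono_neutral_right) (use less in auto)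
    also have "\<dots> = u i + (\<Sum>j\<in>{Suc i..d}. u j)"
      using less.prems by (rule sum.atLeast_Suc_atMost)
    finally have "u i = - (\<Sum>j\<in>{Suc i..d}. u j)" using sum by (simp add: eq_neg_iff_add_eq_0)
    also have "\<dots> \<in> G (Suc i)"
      using u G_mono sub by (intro subspace_neg subspace_sum) (auto simp: U_def)
    finally have "u i \<in> X (Suc i)" using u[OF less.prems] by (auto simp: X_def U_def)
    then show ?case using X0 by simp
  qed
  have "\<exists>P. lin V V P \<and> (\<forall>i\<le>d. \<forall>v\<in>U i. P v = - t i \<cdot> v)"
    by (rule ex_direct_sum_operator[OF U_sub V V_span]) (rule indep)
  then obtain P where P: "lin V V P" and PU: "\<And>i v. i \<le> d \<Longrightarrow> v \<in> U i \<Longrightarrow> P v = - t i \<cdot> v"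
    by blast
  have PU': "P v = - t i \<cdot> v" if "v \<in> U i" for v i
    using that PU[of i v] U_top[of i] by (cases "i \<le> d") (auto simp: lin_zero[OF P])
  have extend: "V \<subseteq> {v \<in> V. R v \<in> {0}}" if R: "lin V V R" and "\<And>i v. v \<in> U i \<Longrightarrow> i \<le> d \<Longrightarrow> R v = 0" for R
  proof (rule subset_trans[OF V_span], rule span_minimal)
    show "subspace {v \<in> V. R v \<in> {0}}" using R by (rule subspace_preimage) simp
  qed (use that in \<open>auto intro: subsetD[OF U_sub(2)]\<close>)
  \<comment> \<open>With x = A v - t i v in \<open>U (i - 1)\<close>, where \<open>P\<close> is -(t
    i + 2), both [A, P] v and 2 A v + 2 P v equal 2 x. This is why \<open>P\<close> must be minus
    \<open>t i\<close> on \<open>U i\<close>. Below, the same holds for x = B v - t i v in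
    \<open>U (Suc i)\<close>.\<close>
  have "comm A P v - (2 \<cdot> A v + 2 \<cdot> P v) = 0" if "v \<in> V" for v
  proof -
    have "comm A P v - (2 \<cdot> A v + 2 \<cdot> P v) = 0" if v: "v \<in> U i" for v i
    proof -
      define x where "x = A v - t i \<cdot> v"
      have Ax: "A v = x + t i \<cdot> v" by (simp add: x_def)
      have vV: "v \<in> V" "x \<in> V" using v AU[OF v] U_sub by (auto simp: x_def)
      have Px: "P x = - (t i + 2) \<cdot> x"
      proof (cases i)
        case 0
        then show ?thesis using AU0[OF v] by (simp add: x_def lin_zero[OF P])
      next
        case (Suc j)
        then show ?thesis using PU'[OF AU[OF v]] by (simp add: x_def t_def algebra_simps)
      qed
      show ?thesis
        using vV V by (simp add: comm_def PU'[OF v] Ax Px lin_simps[OF P] lin_simps[OF A] subspace_mem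
            scale_left_distrib scale_right_distrib scale_left_diff_distrib scale_right_diff_distrib mult.commute)
    qed
    then show ?thesis
      using extend[OF lin_sub[OF lin_comm[OF A P] lin_plus[OF lin_scaled[OF A] lin_scaled[OF P]]]] that
      by blast
  qed
  moreover have "comm P B v - (2 \<cdot> P v + 2 \<cdot> B v) = 0" if "v \<in> V" for v
  proof -
    have "comm P B v - (2 \<cdot> P v + 2 \<cdot> B v) = 0" if v: "v \<in> U i" "i \<le> d" for v i
    proof -
      define x where "x = B v - t i \<cdot> v"
      have Bx: "B v = x + t i \<cdot> v" by (simp add: x_def)
      have vV: "v \<in> V" "x \<in> V" using v BU[OF v] U_sub by (auto simp: x_def)
      have Px: "P x = - (t i - 2) \<cdot> x"
        using PU'[OF BU[OF v]] by (simp add: x_def t_def algebra_simps)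
      show ?thesis
        using vV V by (simp add: comm_def PU'[OF v(1)] Bx Px lin_simps[OF P] lin_simps[OF B] subspace_mem
            scale_left_distrib scale_right_distrib scale_left_diff_distrib scale_right_diff_distrib mult.commute)
    qed
    then show ?thesis
      using extend[OF lin_sub[OF lin_comm[OF P B] lin_plus[OF lin_scaled[OF P] lin_scaled[OF B]]]] that
      by blast
  qed
  ultimately have "adj V A P \<and> adj V P B" using A B P by (simp add: adj_def)
  then show ?thesis by blast
qed


section \<open>Submodules\<close>

text \<open>For comparing eigenvalues only the existence of an operator in between matters, which
  lets the four choices of signs be treated alike.\<close>

definition linked :: "'v set \<Rightarrow> ('v \<Rightarrow> 'v) \<Rightarrow> ('v \<Rightarrow> 'v) \<Rightarrow> bool" where
  "linked V A B \<longleftrightarrow> (\<exists>P. adj V A P \<and> adj V P B)"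

lemma linked_neg: "linked V A B \<Longrightarrow> linked V (neg B) (neg A)"
  unfolding linked_def using adj_neg by blast

lemma linked_eigenvalue_le:
  assumes C: "finite C" "span C = V" and "linked V A B"
    and "W \<subseteq> V" "a \<in> eigs W A" "W \<subseteq> esum V B {b - 2 * of_nat i | i. True}"
  shows "\<exists>n. b - a = 2 * of_nat n"
proof -
  obtain P where P: "adj V A P" "adj V P B" using \<open>linked V A B\<close> unfolding linked_def by blast
  obtain w where "w \<in> W" "w \<noteq> 0" "A w = a \<cdot> w" using \<open>a \<in> eigs W A\<close> unfolding eigs_def by blast
  then show ?thesis
    using assms adjD[OF P(1)] adjD[OF P(2)]
    by (intro adj_eigenvalue_le[OF P finite_eigs[OF _ C] finite_eigs[OF _ C], of w]) auto
qed

text \<open>Let a, b be the highest eigenvalues of \<open>A\<close>, \<open>B\<close> on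
  \<open>W\<close>, and 2m, 2n the lengths of their spectra. A link bounds the highest eigenvalue at
  its start by that at its end, so a link and its reverse give equality. The pairs A, B, then A, -B,
  then -A, B yield a = b, a = 2n - b and b = 2m - a, whence a = b = m = n.\<close>

lemma subspace_eigs_weights:
  assumes C: "finite C" "span C = V"
    and link: "linked V A B" "linked V A (neg B)" "linked V (neg A) B" "linked V (neg A) (neg B)"
    and W: "irr W A B" "W \<subseteq> V" and dg: "dolan_grady W A B" "dolan_grady W B A"
  shows "\<exists>d. eigs W A = weights d \<and> eigs W B = weights d"
proof -
  have A: "lin V V A" and B: "lin V V B" using link(1) adjD unfolding linked_def by blast+
  note irr' = irr_swap[OF W(1)]
  have eig: "finite (eigs W A)" "eigs W A \<noteq> {}" "finite (eigs W B)" "eigs W B \<noteq> {}"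
  proof -
    have "eigs W F \<subseteq> eigs V F" for F using W(2) by (auto simp: eigs_def)
    then show "finite (eigs W A)" "finite (eigs W B)"
      using finite_eigs[OF A C] finite_eigs[OF B C] by (meson finite_subset)+
    show "eigs W A \<noteq> {}" "eigs W B \<noteq> {}"
      using eigs_nonempty[OF A C] eigs_nonempty[OF B C] irrD(1,2,3)[OF W(1)] W(2) by auto
  qed
  obtain a m where a: "eigs W A = {a - 2 * of_nat i | i. i \<le> m}"
    using irr_eigs_string[OF W(1) dg(1) eig(1,2)] by blast
  obtain b n where b: "eigs W B = {b - 2 * of_nat i | i. i \<le> n}"
    using irr_eigs_string[OF irr' dg(2) eig(3,4)] by blast
  have full: "esum W A (eigs W A) = W" "esum W B (eigs W B) = W"
  proof -
    obtain c c' where "c \<in> eigs W A" "c' \<in> eigs W B" using eig by blast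
    then show "esum W A (eigs W A) = W" "esum W B (eigs W B) = W"
      by (simp_all add: irr_esum[OF W(1) dg(1)] irr_esum[OF irr' dg(2)])
  qed
  \<comment> \<open>The operator in between is not yet known to preserve \<open>W\<close>, so
    \<open>W\<close> is placed inside sums of eigenspaces of the whole \<open>V\<close>.\<close>
  have below: "W \<subseteq> esum V F {c - 2 * of_nat i | i. True}"
    if "esum W F (eigs W F) = W" "eigs W F = {c - 2 * of_nat i | i. i \<le> k}" for F c and k :: nat
    using esum_mono[OF W(2), of "eigs W F" "{c - 2 * of_nat i | i. True}" F] that by auto
  have above: "W \<subseteq> esum V (neg F) {(2 * of_nat k - c) - 2 * of_nat i | i. True}"
    if F: "esum W F (eigs W F) = W" "eigs W F = {c - 2 * of_nat i | i. i \<le> k}" for F c and k :: nat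
  proof -
    have "eigs W F \<subseteq> uminus ` {(2 * of_nat k - c) - 2 * of_nat i | i. True}"
    proof
      fix x assume "x \<in> eigs W F"
      then obtain i where i: "x = c - 2 * of_nat i" "i \<le> k" using F(2) by blast
      then have "- x = (2 * of_nat k - c) - 2 * of_nat (k - i)" by (simp add: of_nat_diff algebra_simps)
      then show "x \<in> uminus ` {(2 * of_nat k - c) - 2 * of_nat i | i. True}"
        unfolding mem_uminus_image_iff by blast
    qed
    then show ?thesis unfolding esum_neg using esum_mono[OF W(2)] that(1) by blast
  qed
  have mem: "a \<in> eigs W A" "b \<in> eigs W B"
    "2 * of_nat m - a \<in> eigs W (neg A)" "2 * of_nat n - b \<in> eigs W (neg B)"
    unfolding eigs_neg mem_uminus_image_iff a b by (auto intro: exI[of _ 0])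
  note le = linked_eigenvalue_le[OF C _ W(2)]
  have eq: "x = y" if xy: "\<exists>n. y - x = 2 * of_nat n" "\<exists>n. x - y = 2 * of_nat n" for x y :: 'k
  proof -
    obtain k l :: nat where kl: "y - x = 2 * of_nat k" "x - y = 2 * of_nat l" using xy by blast
    then have "(0 :: 'k) = 2 * of_nat k + 2 * of_nat l" by (simp flip: kl)
    then have "of_nat (2 * k + 2 * l) = (0 :: 'k)" by simp
    then have "k = 0" by (simp only: of_nat_eq_0_iff)
    then show ?thesis using kl by simp
  qed
  have link': "linked V B A" "linked V (neg B) A" "linked V B (neg A)"
    using linked_neg[OF link(4)] linked_neg[OF link(3)] linked_neg[OF link(2)] by simp_all
  have "a = b"
    using le[OF link(1) mem(1) below[OF full(2) b]] le[OF link'(1) mem(2) below[OF full(1) a]]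
    by (rule eq)
  have "a = 2 * of_nat n - b"
    using le[OF link(2) mem(1) above[OF full(2) b]] le[OF link'(2) mem(4) below[OF full(1) a]]
    by (rule eq)
  then have an: "a = of_nat n" using \<open>a = b\<close> by (simp add: eq_diff_eq)
  have "b = 2 * of_nat m - a"
    using le[OF link'(3) mem(2) above[OF full(1) a]] le[OF link(3) mem(3) below[OF full(2) b]]
    by (rule eq)
  then have "a = of_nat m" using \<open>a = b\<close> by (simp add: eq_diff_eq)
  with an have "m = n" by simp
  then have "eigs W A = weights n" "eigs W B = weights n"
    using a b an \<open>a = b\<close> unfolding weights_def by auto
  then show ?thesis by blast
qed

text \<open>
  The split decomposition of \<open>W\<close> gives an operator \<open>P'\<close> on \<open>W\<close> with the same relations. If \<open>P \<noteq> P'\<close> on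
  \<open>W\<close>, then \<open>P - P'\<close> maps a highest eigenvector of \<open>A\<close> to an eigenvector that violates
  \<open>adj_eigenvalue_le\<close>.
\<close>

lemma subspace_invariant_adj:
  assumes C: "finite C" "span C = V" and P: "adj V A P" "adj V P B"
    and W: "irr W A B" "W \<subseteq> V" and dg: "dolan_grady W A B" "dolan_grady W B A"
    and eA: "eigs W A = weights d" and eB: "eigs W B = weights d" and w: "w \<in> W"
  shows "P w \<in> W"
proof -
  note A = adjD(1)[OF P(1)] and B = adjD(2)[OF P(2)] and lP = adjD(2)[OF P(1)]
  note V = lin_subspaces(1)[OF A]
  note AW = irrD(2)[OF W(1)] and BW = irrD(3)[OF W(1)]
  obtain P' where P': "adj W A P'" "adj W P' B"
    using ex_adj_between[OF W(1) dg eA eB] by blast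
  note lP' = adjD(2)[OF P'(1)]
  note sW = lin_subspaces(1)[OF lP']
  define D where "D v = P v - P' v" for v
  have D: "lin W V D" unfolding D_def
    by (intro lin_sub lin_mono[OF lP sW W(2) V] lin_mono[OF lP' sW _ V])
      (use W(2) lin_mem[OF lP] lin_mem[OF lP'] in auto)
  \<comment> \<open>The inhomogeneous terms 2A and 2B are common to \<open>P\<close> and
    \<open>P'\<close> and cancel in the difference.\<close>
  have AD: "A (D v) = D (A v) + 2 \<cdot> D v" if v: "v \<in> W" for v
  proof -
    have "v \<in> V" "P v \<in> V" "P' v \<in> V" using v W(2) lin_mem[OF lP] lin_mem[OF lP'] by auto
    then show ?thesis unfolding D_def using adjD(3)[OF P(1), of v] adjD(3)[OF P'(1) v]
      by (simp add: lin_diff[OF A] scale_right_diff_distrib)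
  qed
  have BD: "B (D v) = D (B v) + (- 2) \<cdot> D v" if v: "v \<in> W" for v
  proof -
    have *: "v \<in> V" "P v \<in> V" "P' v \<in> V" using v W(2) lin_mem[OF lP] lin_mem[OF lP'] by auto
    have "B (P v) = P (B v) - 2 \<cdot> P v - 2 \<cdot> B v" "B (P' v) = P' (B v) - 2 \<cdot> P' v - 2 \<cdot> B v"
      using adjD(3)[OF P(2) *(1)] adjD(3)[OF P'(2) v] by (simp_all add: algebra_simps)
    then show ?thesis unfolding D_def using *
      by (simp add: lin_diff[OF B] scale_right_diff_distrib)
  qed
  obtain t where t: "t \<in> W" "t \<noteq> 0" "A t = of_nat d \<cdot> t"
    using of_nat_mem_weights[of d] unfolding eA[symmetric] eigs_def by blast
  have "esum W B (weights d) = W"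
    using irr_esum[OF irr_swap[OF W(1)] dg(2), of "of_nat d" "weights d"] of_nat_mem_weights eB
    by auto
  with t(1) have "t \<in> esum W B (weights d)" by simp
  then have "D t \<in> esum V B {of_nat d - 2 - 2 * of_nat i | i. True}"
  proof (rule esum_map[OF D subspace_esum, rotated])
    fix v c assume v: "v \<in> W" "c \<in> weights d" "B v = c \<cdot> v"
    then obtain i :: nat where i: "c = of_nat d - 2 * of_nat i" unfolding weights_def by blast
    have "B (D v) = (c - 2) \<cdot> D v"
      using BD[OF v(1)] v lin_scale[OF D v(1)] by (simp add: scale_left_diff_distrib)
    then show "D v \<in> esum V B {of_nat d - 2 - 2 * of_nat i | i. True}"
      using lin_mem[OF D v(1)] i by (intro esum_base[of _ _ "c - 2"]) auto
  qed
  \<comment> \<open>\<open>D t\<close> has eigenvalue d + 2 for \<open>A\<close> and components for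
    \<open>B\<close> only at d - 2 and below. A nonzero \<open>D t\<close> would make (d - 2) - (d +
    2) = -4 twice a natural number.\<close>
  moreover have "A (D t) = (of_nat d + 2) \<cdot> D t"
    using AD[OF t(1)] t(3) lin_scale[OF D t(1)] by (simp add: scale_left_distrib)
  ultimately have "D t = 0"
    using adj_eigenvalue_le[OF P finite_eigs[OF A C] finite_eigs[OF B C] lin_mem[OF D t(1)]]
  proof (rule_tac ccontr)
    assume le: "\<And>a b. D t \<noteq> 0 \<Longrightarrow> A (D t) = a \<cdot> D t \<Longrightarrow>
      D t \<in> esum V B {b - 2 * of_nat i | i. True} \<Longrightarrow> \<exists>n. b - a = 2 * of_nat n"
      and "D t \<noteq> 0" "A (D t) = (of_nat d + 2) \<cdot> D t"
        "D t \<in> esum V B {of_nat d - 2 - 2 * of_nat i | i. True}"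
    then obtain n :: nat where "of_nat d - 2 - (of_nat d + 2) = (2 * of_nat n :: 'k)" by blast
    then have "of_nat (2 * n + 4) = (0 :: 'k)" by (simp add: algebra_simps)
    then show False by (simp only: of_nat_eq_0_iff)
  qed
  then have "D w = 0"
    using irr_intertwiner_zero[OF W(1) D lin_zero[OF A] lin_zero[OF B] AD BD t(1,2) _ w] by blast
  then show ?thesis unfolding D_def using lin_mem[OF lP' w] by simp
qed

section \<open>The relations between the operators of the split decompositions\<close>

text \<open>Small numerals are expanded into sums, so that the commutator computations below become
  identities in the additive group.\<close>

lemma scale_two: "2 \<cdot> x = x + x"
  by (metis one_add_one scale_left_distrib scale_one)

lemma scale_four: "4 \<cdot> x = x + x + x + x"
proof -
  have "4 \<cdot> x = 2 \<cdot> (2 \<cdot> x)" by simp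
  then show ?thesis by (simp only: scale_two add.assoc)
qed

lemma scale_eight: "8 \<cdot> x = 4 \<cdot> x + 4 \<cdot> x"
  by (simp flip: scale_left_distrib)

lemma scale_sixteen: "16 \<cdot> x = 8 \<cdot> x + 8 \<cdot> x"
  by (simp flip: scale_left_distrib)

text \<open>With \<open>T = [P, -R] - 2P + 2R\<close>, one has \<open>[A, T] = 0\<close> and \<open>[B, T] = -4T\<close>.\<close>

lemma adj_triangle:
  assumes irr: "irr V A B" and eB: "eigs V B = weights d"
    and AP: "adj V A P" and PB: "adj V P B" and AR: "adj V (neg A) R" and RB: "adj V R B"
  shows "adj V P (neg R)"
proof -
  note A = irrD(2)[OF irr] and B = irrD(3)[OF irr] and P = adjD(2)[OF AP] and R = adjD(2)[OF AR]
  note V = lin_subspaces(1)[OF A]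
  \<comment> \<open>In the roles of \<open>X\<^sub>1\<^sub>2\<close> and
    \<open>X\<^sub>0\<^sub>2\<close> for \<open>P\<close> and \<open>R\<close>, this is the defect
    of the relation between \<open>X\<^sub>1\<^sub>2\<close> and
    \<open>X\<^sub>2\<^sub>0\<close>.\<close>
  define T where "T v = comm P (neg R) v - (2 \<cdot> P v + 2 \<cdot> (- R v))" for v
  have T: "lin V V T" unfolding T_def by (intro lin_sub lin_plus lin_scaled lin_comm P R lin_neg)
  have T': "T v = R (P v) + R v + R v - P (R v) - P v - P v" if "v \<in> V" for v
    using that by (simp add: T_def comm_def lin_minus[OF P] lin_mem[OF R] scale_two)
  have rules: "A (P v) = P (A v) + A v + A v + P v + P v"
    "A (R v) = R (A v) + A v + A v - R v - R v"
    "B (P v) = P (B v) - P v - P v - B v - B v"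
    "B (R v) = R (B v) - R v - R v - B v - B v" if "v \<in> V" for v
    using adjD(3)[OF AP that] adjD(3)[OF AR that] adjD(3)[OF PB that] adjD(3)[OF RB that] that
    by (simp_all add: scale_two lin_minus[OF R] lin_mem[OF A] algebra_simps)
  note s = lin_simps[OF A] lin_simps[OF B] lin_simps[OF P] lin_simps[OF R] subspace_mem[OF V]
  have AT: "A (T v) = T (A v) + 0 \<cdot> T v" if "v \<in> V" for v
    using that by (simp add: T' s rules algebra_simps)
  have BT: "B (T v) = T (B v) + (- 4) \<cdot> T v" if "v \<in> V" for v
    using that by (simp add: T' s rules scale_four algebra_simps)
  \<comment> \<open>\<open>T\<close> commutes with \<open>A\<close>, so only \<open>B\<close> can
    help: its lowest eigenvector would be moved to -d - 4.\<close>
  have "- of_nat d \<in> eigs V B"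
    using of_nat_mem_weights[of d] mem_uminus_image_iff[of "- of_nat d" "weights d"]
    by (simp add: eB uminus_weights)
  then obtain v where v: "v \<in> V" "v \<noteq> 0" "B v = (- of_nat d) \<cdot> v" unfolding eigs_def by blast
  have "B (T v) = (- of_nat d - 2 * of_nat 2) \<cdot> T v"
    using BT[OF v(1)] v lin_scale[OF T v(1), of "- of_nat d"] by (simp add: scale_left_diff_distrib)
  moreover have "- of_nat d - 2 * of_nat 2 \<notin> eigs V B"
    unfolding eB by (rule of_nat_add_even_notin_weights) simp
  ultimately have "T v = 0" using lin_mem[OF T v(1)] unfolding eigs_def by blast
  then have "T w = 0" if "w \<in> V" for w
    using irr_intertwiner_zero[OF irr T lin_zero[OF A] lin_zero[OF B] AT BT v(1,2) _ that] by blast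
  then show ?thesis using P R by (simp add: adj_def T_def lin_neg)
qed

text \<open>With \<open>T = [P, [P, [P, R]]] - 4[P, R]\<close>, one has \<open>[A, T] = 4T\<close> and \<open>[B, T] = -4T\<close>.\<close>

lemma dolan_grady_opposite:
  assumes irr: "irr V A B" and eA: "eigs V A = weights d"
    and AP: "adj V A P" and PB: "adj V P B" and AR: "adj V (neg A) R" and RB: "adj V R (neg B)"
  shows "dolan_grady V P R"
proof -
  note A = irrD(2)[OF irr] and B = irrD(3)[OF irr] and P = adjD(2)[OF AP] and R = adjD(2)[OF AR]
  note V = lin_subspaces(1)[OF A]
  define T where "T v = comm P (comm P (comm P R)) v - 4 \<cdot> comm P R v" for v
  have T: "lin V V T" unfolding T_def by (intro lin_sub lin_scaled lin_comm P R)
  define W where "W = comm P R"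
  define X where "X = comm P W"
  define Y where "Y = comm P X"
  have W: "lin V V W" and X: "lin V V X" and Y: "lin V V Y"
    unfolding W_def X_def Y_def by (intro lin_comm P R)+
  have PR: "P (R v) = R (P v) + W v" and PW: "P (W v) = W (P v) + X v" for v
    by (simp_all add: W_def X_def comm_def)
  have rules: "A (P v) = P (A v) + A v + A v + P v + P v"
    "A (R v) = R (A v) + A v + A v - R v - R v"
    "B (P v) = P (B v) - P v - P v - B v - B v"
    "B (R v) = R (B v) + R v + R v - B v - B v" if "v \<in> V" for v
    using adjD(3)[OF AP that] adjD(3)[OF AR that] adjD(3)[OF PB that] adjD(3)[OF RB that] that
    by (simp_all add: scale_two lin_minus[OF R] lin_mem[OF A] lin_mem[OF B] algebra_simps)
  note s = lin_simps[OF A] lin_simps[OF B] lin_simps[OF P] lin_simps[OF R] lin_simps[OF W]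
    lin_simps[OF X] lin_simps[OF Y] subspace_mem[OF V]
  have W': "W v = P (R v) - R (P v)" and X': "X v = P (W v) - W (P v)"
    and Y': "Y v = P (X v) - X (P v)" for v
    by (simp_all add: W_def X_def Y_def comm_def)
  have T': "T v = Y v - 4 \<cdot> W v" for v
    by (simp add: T_def Y_def X_def W_def)
  \<comment> \<open>A commutator with \<open>A\<close> is a derivation, so it is computed one
    nesting level at a time from [A, P] and [A, R]; likewise for \<open>B\<close>.\<close>
  have AW: "A (W v) = W (A v) - 4 \<cdot> (R v + P v)" if "v \<in> V" for v
    unfolding W' using that by (simp add: s rules scale_four algebra_simps)
  have AX: "A (X v) = X (A v) - 8 \<cdot> (R v + P v) + 2 \<cdot> X v - 4 \<cdot> W v" if "v \<in> V" for v
    unfolding X' using that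
    by (simp add: s rules AW PR scale_two scale_four scale_eight algebra_simps)
  have AY: "A (Y v) = Y (A v) - 16 \<cdot> (R v + P v + W v) + 4 \<cdot> Y v" if "v \<in> V" for v
    unfolding Y' using that
    by (simp add: s rules AX PR PW scale_two scale_four scale_eight scale_sixteen algebra_simps)
  have AT: "A (T v) = T (A v) + 4 \<cdot> T v" if "v \<in> V" for v
    unfolding T' using that
    by (simp add: s AW AY scale_right_distrib scale_right_diff_distrib)
  have BW: "B (W v) = W (B v) - 4 \<cdot> (R v + P v)" if "v \<in> V" for v
    unfolding W' using that by (simp add: s rules scale_four algebra_simps)
  have BX: "B (X v) = X (B v) + 8 \<cdot> (R v + P v) - 2 \<cdot> X v - 4 \<cdot> W v" if "v \<in> V" for v
    unfolding X' using that
    by (simp add: s rules BW PR scale_two scale_four scale_eight algebra_simps)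
  have BY: "B (Y v) = Y (B v) - 16 \<cdot> (R v + P v - W v) - 4 \<cdot> Y v" if "v \<in> V" for v
    unfolding Y' using that
    by (simp add: s rules BX PR PW scale_two scale_four scale_eight scale_sixteen algebra_simps)
  have BT: "B (T v) = T (B v) + (- 4) \<cdot> T v" if "v \<in> V" for v
    unfolding T' using that
    by (simp add: s BW BY scale_right_distrib scale_right_diff_distrib)
  \<comment> \<open>The highest eigenvector of \<open>A\<close> would be moved to d + 4.\<close>
  obtain v where v: "v \<in> V" "v \<noteq> 0" "A v = of_nat d \<cdot> v"
    using of_nat_mem_weights[of d] unfolding eA[symmetric] eigs_def by blast
  have "A (T v) = (of_nat d + 2 * of_nat 2) \<cdot> T v"
    using AT[OF v(1)] v lin_scale[OF T v(1), of "of_nat d"] by (simp add: scale_left_distrib)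
  moreover have "of_nat d + 2 * of_nat 2 \<notin> eigs V A"
    unfolding eA by (rule of_nat_add_even_notin_weights) simp
  ultimately have "T v = 0" using lin_mem[OF T v(1)] unfolding eigs_def by blast
  then have "T w = 0" if "w \<in> V" for w
    using irr_intertwiner_zero[OF irr T lin_zero[OF A] lin_zero[OF B] AT BT v(1,2) _ that] by blast
  then show ?thesis by (simp add: dolan_grady_def T_def)
qed


section \<open>Operators that agree on the subspace, and changes of sign\<close>

lemma lin_cong:
  assumes f: "lin V W f" and "\<And>v. v \<in> V \<Longrightarrow> f v = g v"
  shows "lin V W g"
  using lin_subspaces[OF f]
  by (intro linI) (simp_all add: subspace_mem lin_simps[OF f] flip: assms(2))

lemma adj_cong:
  assumes "adj V F G" "\<And>v. v \<in> V \<Longrightarrow> F v = F' v" "\<And>v. v \<in> V \<Longrightarrow> G v = G' v"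
  shows "adj V F' G'"
  using assms lin_cong[of V V F F'] lin_cong[of V V G G'] lin_mem[of V V F] lin_mem[of V V G]
  by (auto simp: adj_def comm_def)

text \<open>Both sides have odd degree in \<open>A\<close>, namely 3 and 1, so the sign cancels. The
  nested commutators agree on \<open>V\<close> only, hence the congruence \<open>c\<close> for the
  inner argument.\<close>

lemma dolan_grady_neg_left:
  assumes A: "lin V V A" and B: "lin V V B" and dg: "dolan_grady V A B"
  shows "dolan_grady V (neg A) B"
proof -
  have *: "comm (neg A) F v = - comm A F v" if "lin V V F" "v \<in> V" for F v
    using that by (simp add: comm_def lin_minus[OF that(1)] lin_mem[OF A])
  have **: "comm A (neg F) v = - comm A F v" if "lin V V F" "v \<in> V" for F v
    using that by (simp add: comm_def lin_minus[OF A] lin_mem[OF that(1)])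
  have c: "comm A F v = comm A G v" if "\<And>v. v \<in> V \<Longrightarrow> F v = G v" "v \<in> V" for F G v
    using that by (simp add: comm_def lin_mem[OF A])
  note L = lin_comm[OF A B] lin_comm[OF A lin_comm[OF A B]] lin_comm[OF lin_neg[OF A] B]
    lin_comm[OF lin_neg[OF A] lin_comm[OF lin_neg[OF A] B]]
  show ?thesis
    unfolding dolan_grady_def
  proof
    fix v assume v: "v \<in> V"
    have 1: "comm (neg A) (comm (neg A) B) u = comm A (comm A B) u" if "u \<in> V" for u
      using that c[of "comm (neg A) B" "neg (comm A B)" u] by (simp add: * ** B L)
    have "comm (neg A) (comm (neg A) (comm (neg A) B)) v = - comm A (comm A (comm A B)) v"
      using v c[OF 1 v] by (simp add: * L)
    also have "\<dots> = 4 \<cdot> comm (neg A) B v"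
      using dg v by (simp add: dolan_grady_def * B)
    finally show "comm (neg A) (comm (neg A) (comm (neg A) B)) v = 4 \<cdot> comm (neg A) B v" .
  qed
qed

lemma dolan_grady_neg_right:
  assumes A: "lin V V A" and B: "lin V V B" and dg: "dolan_grady V A B"
  shows "dolan_grady V A (neg B)"
proof -
  have **: "comm A (neg F) v = - comm A F v" if "lin V V F" "v \<in> V" for F v
    using that by (simp add: comm_def lin_minus[OF A] lin_mem[OF that(1)])
  have c: "comm A F v = - comm A G v" if "\<And>v. v \<in> V \<Longrightarrow> F v = - G v" "lin V V G" "v \<in> V" for F G v
    using that by (simp add: comm_def lin_mem[OF A] lin_minus[OF A] lin_mem[OF that(2)])
  note L = B lin_comm[OF A B] lin_comm[OF A lin_comm[OF A B]]
  show ?thesis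
    using dg c[OF c[OF ** L(2)] L(3)] ** B by (simp add: dolan_grady_def L)
qed

lemma dolan_grady_neg:
  assumes "dolan_grady V A B" "lin V V A" "lin V V B"
  shows "dolan_grady V (neg A) B" "dolan_grady V A (neg B)" "dolan_grady V (neg A) (neg B)"
  using dolan_grady_neg_left dolan_grady_neg_right lin_neg assms by blast+

section \<open>Modules given by generators\<close>

primrec eval :: "('g \<Rightarrow> 'v \<Rightarrow> 'v) \<Rightarrow> ('g, 'k) lie_term \<Rightarrow> 'v \<Rightarrow> 'v" where
  "eval \<rho> (LGen g) = \<rho> g"
| "eval \<rho> LZero = (\<lambda>v. 0)"
| "eval \<rho> (LAdd s t) = (\<lambda>v. eval \<rho> s v + eval \<rho> t v)"
| "eval \<rho> (LScale a t) = (\<lambda>v. a \<cdot> eval \<rho> t v)"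
| "eval \<rho> (LBr s t) = comm (eval \<rho> s) (eval \<rho> t)"

lemma lin_eval:
  assumes "subspace V" "\<And>g. lin V V (\<rho> g)"
  shows "lin V V (eval \<rho> t)"
  by (induction t)
    (simp_all add: assms lin_zero_map lin_plus lin_scaled lin_comm del: split_paired_All)

text \<open>The linear maps on \<open>V\<close> form a Lie algebra under \<open>comm\<close>, so the
  axioms hold automatically and only the relations in \<open>R\<close> are left to check.\<close>

lemma eval_respects_lie_cong:
  assumes V: "subspace V" "\<And>g. lin V V (\<rho> g)"
    and R: "\<And>s t v. (s, t) \<in> R \<Longrightarrow> v \<in> V \<Longrightarrow> eval \<rho> s v = eval \<rho> t v"
    and "lie_cong R s t" "v \<in> V"
  shows "eval \<rho> s v = eval \<rho> t v"
  using assms(4,5)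
proof (induction arbitrary: v rule: lie_cong.induct)
  case (cong_br s s' t t')
  then show ?case by (simp add: comm_def lin_mem[OF lin_eval[OF V]])
qed (simp_all add: R comm_def lin_mem[OF lin_eval[OF V]] lin_add[OF lin_eval[OF V]]
    lin_scale[OF lin_eval[OF V]] lin_diff[OF lin_eval[OF V]] scale_right_distrib scale_left_distrib
    scale_right_diff_distrib algebra_simps)

lemma lie_module_lin: "lie_module scaleL br scale M \<Longrightarrow> lin (carrier M) (carrier M) (act M x)"
  unfolding lie_module_def lin_def by blast

lemma lie_module_act:
  assumes "lie_module scaleL br scale M" "v \<in> carrier M"
  shows "act M (x + y) v = act M x v + act M y v" "act M (scaleL c x) v = c \<cdot> act M x v"
    "act M (br x y) v = comm (act M x) (act M y) v"
  using assms unfolding lie_module_def comm_def by blast+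

lemma lie_module_act_zero:
  assumes "lie_module scaleL br scale M" "v \<in> carrier M"
  shows "act M 0 v = 0"
  using lie_module_act(1)[OF assms, of 0 0] by simp

end

text \<open>The two algebras are separate types built in the same way. The locale collects what both
  quotients provide, so that modules given by generators are treated once.\<close>

locale lie_presentation = alg_closed_space scale
  for scale :: "'k::{alg_closed_field, field_char_0} \<Rightarrow> 'v::ab_group_add \<Rightarrow> 'v" (infixr \<open>\<cdot>\<close> 75) +
  fixes R :: "(('g, 'k) lie_term \<times> ('g, 'k) lie_term) set"
    and quot :: "('g, 'k) lie_term \<Rightarrow> 'l::ab_group_add"
    and scaleL :: "'k \<Rightarrow> 'l \<Rightarrow> 'l" and br :: "'l \<Rightarrow> 'l \<Rightarrow> 'l"
  assumes quot_eq_iff: "quot s = quot t \<longleftrightarrow> lie_cong R s t"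
    and surj_quot: "surj quot"
    and quot_zero: "quot LZero = 0"
    and quot_add: "quot (LAdd s t) = quot s + quot t"
    and quot_scale: "quot (LScale a t) = scaleL a (quot t)"
    and quot_br: "quot (LBr s t) = br (quot s) (quot t)"
begin

lemma quot_induct:
  assumes "\<And>g. P (quot (LGen g))" "P 0" "\<And>x y. P x \<Longrightarrow> P y \<Longrightarrow> P (x + y)"
    "\<And>a x. P x \<Longrightarrow> P (scaleL a x)" "\<And>x y. P x \<Longrightarrow> P y \<Longrightarrow> P (br x y)"
  shows "P x"
proof -
  have "P (quot t)" for t
    by (induction t) (simp_all add: assms quot_zero quot_add quot_scale quot_br)
  then show ?thesis using surj_quot by (metis surjD)
qed

lemma invariant_if_generators:
  assumes M: "lie_module scaleL br scale M" and W: "subspace W" "W \<subseteq> carrier M"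
    and gen: "\<And>g w. w \<in> W \<Longrightarrow> act M (quot (LGen g)) w \<in> W" and "w \<in> W"
  shows "act M x w \<in> W"
proof -
  have "\<forall>w\<in>W. act M x w \<in> W"
  proof (induction x rule: quot_induct)
    case (5 x y)
    show ?case
    proof
      fix w assume "w \<in> W"
      with 5 show "act M (br x y) w \<in> W"
        by (simp add: lie_module_act[OF M subsetD[OF W(2)]] comm_def subspace_diff[OF W(1)])
    qed
  qed (use W in \<open>auto simp: gen lie_module_act[OF M] lie_module_act_zero[OF M] subsetD[OF W(2)]
      subspace_0 subspace_add subspace_scale\<close>)
  then show ?thesis using \<open>w \<in> W\<close> by blast
qed

lemma intertwiner_if_generators:
  assumes M: "lie_module scaleL br scale M" and N: "lie_module scaleL br scale N"
    and f: "lin (carrier M) (carrier N) f"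
    and gen: "\<And>g v. v \<in> carrier M \<Longrightarrow> f (act M (quot (LGen g)) v) = act N (quot (LGen g)) (f v)"
    and "v \<in> carrier M"
  shows "f (act M x v) = act N x (f v)"
proof -
  note lM = lie_module_lin[OF M] and lN = lie_module_lin[OF N]
  have "\<forall>v\<in>carrier M. f (act M x v) = act N x (f v)"
    by (induction x rule: quot_induct)
      (simp_all add: gen lie_module_act[OF M] lie_module_act_zero[OF M] lie_module_act[OF N]
        lie_module_act_zero[OF N] lin_mem[OF f] lin_zero[OF f] lin_add[OF f] lin_scale[OF f]
        lin_diff[OF f] lin_mem[OF lM] comm_def)
  then show ?thesis using \<open>v \<in> carrier M\<close> by blast
qed

text \<open>An element acts through an arbitrary term that represents it; by
  \<open>act_induced_module\<close> the choice is immaterial on \<open>V\<close> once the relations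
  hold.\<close>

definition induced_module :: "'v set \<Rightarrow> ('g \<Rightarrow> 'v \<Rightarrow> 'v) \<Rightarrow> ('l, 'v) lie_mod" where
  "induced_module V \<rho> = \<lparr>carrier = V, act = \<lambda>x. eval \<rho> (SOME t. quot t = x)\<rparr>"

lemma carrier_induced_module: "carrier (induced_module V \<rho>) = V"
  by (simp add: induced_module_def)

context
  fixes V \<rho>
  assumes V: "subspace V" "\<And>g. lin V V (\<rho> g)"
    and R: "\<And>s t v. (s, t) \<in> R \<Longrightarrow> v \<in> V \<Longrightarrow> eval \<rho> s v = eval \<rho> t v"
begin

lemma act_induced_module: "v \<in> V \<Longrightarrow> act (induced_module V \<rho>) (quot t) v = eval \<rho> t v"
proof -
  have "quot (SOME s. quot s = quot t) = quot t" by (rule someI[of _ t]) simp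
  then have "lie_cong R (SOME s. quot s = quot t) t" by (simp add: quot_eq_iff)
  then show "v \<in> V \<Longrightarrow> act (induced_module V \<rho>) (quot t) v = eval \<rho> t v"
    unfolding induced_module_def by (simp add: eval_respects_lie_cong[OF V R])
qed

lemma lie_module_induced_module: "lie_module scaleL br scale (induced_module V \<rho>)"
proof -
  let ?M = "induced_module V \<rho>"
  have ex: "\<exists>t. x = quot t" for x using surj_quot by (metis surjD)
  note lin_t = lin_eval[of V \<rho>, OF V]
  have l: "lin V V (act ?M x)" for x
  proof -
    obtain t where "x = quot t" using ex by blast
    then show ?thesis using act_induced_module lin_cong[OF lin_t] by simp
  qed
  have "act ?M (x + y) v = act ?M x v + act ?M y v"
    "act ?M (scaleL c x) v = c \<cdot> act ?M x v"
    "act ?M (br x y) v = act ?M x (act ?M y v) - act ?M y (act ?M x v)" if "v \<in> V" for x y c v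
  proof -
    obtain s t where st: "x = quot s" "y = quot t" using ex by meson
    note a = act_induced_module
    show "act ?M (x + y) v = act ?M x v + act ?M y v"
      unfolding st quot_add[symmetric] using that by (simp add: a)
    show "act ?M (scaleL c x) v = c \<cdot> act ?M x v"
      unfolding st quot_scale[symmetric] using that by (simp add: a)
    show "act ?M (br x y) v = act ?M x (act ?M y v) - act ?M y (act ?M x v)"
      unfolding st quot_br[symmetric] using that by (simp add: a lin_mem[OF lin_t] comm_def)
  qed
  then show ?thesis
    unfolding lie_module_def carrier_induced_module
    using V(1) lin_mem[OF l] lin_add[OF l] lin_scale[OF l] by blast
qed

end

end

section \<open>Modules of the two algebras\<close>

context alg_closed_space begin

sublocale onsager: lie_presentation scale onsager_rel abs_onsager onsager_scale onsager_br
proof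
  show "surj abs_onsager" by (rule surjI) (rule Quotient3_abs_rep[OF Quotient3_onsager])
qed (simp_all add: onsager.abs_eq_iff zero_onsager_def plus_onsager.abs_eq onsager_scale.abs_eq
    onsager_br.abs_eq)

sublocale tet: lie_presentation scale tet_rel abs_tetrahedron tet_scale tet_br
proof
  show "surj abs_tetrahedron" by (rule surjI) (rule Quotient3_abs_rep[OF Quotient3_tetrahedron])
qed (simp_all add: tetrahedron.abs_eq_iff zero_tetrahedron_def plus_tetrahedron.abs_eq tet_scale.abs_eq
    tet_br.abs_eq)

lemma abs_onsager_gen: "abs_onsager (LGen g) = (case g of OX \<Rightarrow> onsager_X | OY \<Rightarrow> onsager_Y)"
  by (simp add: onsager_X_def onsager_Y_def split: onsager_gen.split)

lemma abs_tetrahedron_gen_cases: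
  obtains r s where "r \<noteq> s" "{r, s} \<subseteq> {0, 1, 2, 3}"
    "abs_tetrahedron (LGen g) = tet_X r s"
proof -
  obtain r s where rs: "Rep_tet_gen g = (r, s)" by (cases "Rep_tet_gen g")
  then have "r \<noteq> s" "{r, s} \<subseteq> {0, 1, 2, 3}" using Rep_tet_gen[of g] by auto
  moreover have "g = Abs_tet_gen (r, s)" using Rep_tet_gen_inverse[of g] rs by simp
  ultimately show ?thesis using that by (simp add: tet_X_def)
qed


lemma lie_module_dolan_grady:
  fixes N :: "('l::ab_group_add, 'v) lie_mod"
  assumes N: "lie_module sc br scale N" and "br x (br x (br x y)) = sc 4 (br x y)"
  shows "dolan_grady (carrier N) (act N x) (act N y)"
  unfolding dolan_grady_def
proof
  note lN = lie_module_lin[OF N]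
  note c = lie_module_act(3)[OF N]
  have cong: "comm (act N x) F v = comm (act N x) G v"
    if "\<And>v. v \<in> carrier N \<Longrightarrow> F v = G v" "v \<in> carrier N" for F G v
    using that by (simp add: comm_def lin_mem[OF lN])
  fix v assume v: "v \<in> carrier N"
  have 1: "comm (act N x) (comm (act N x) (act N y)) u = act N (br x (br x y)) u"
    if "u \<in> carrier N" for u
    using cong[of _ "act N (br x y)", OF c[symmetric] that] c[OF that] by simp
  have "comm (act N x) (comm (act N x) (comm (act N x) (act N y))) v = act N (br x (br x (br x y))) v"
    using cong[OF 1 v] c[OF v] by simp
  also have "\<dots> = 4 \<cdot> comm (act N x) (act N y) v"
    unfolding assms(2) by (simp add: lie_module_act[OF N v])
  finally show "comm (act N x) (comm (act N x) (comm (act N x) (act N y))) v = 4 \<cdot> comm (act N x) (act N y) v" .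
qed

subsection \<open>Irreducible modules of the tetrahedron algebra\<close>

context
  fixes M :: "('k tetrahedron, 'v) lie_mod"
  assumes M: "M \<in> tet_irreps scale"
begin

abbreviation (input) X :: "nat \<Rightarrow> nat \<Rightarrow> 'v \<Rightarrow> 'v" where
  "X r s \<equiv> act M (tet_X r s)"

lemma tet_irrep_lie_module: "lie_module tet_scale tet_br scale M"
  using M by (simp add: fd_irreducible_modules_def)

lemma tet_irrep_adj:
  assumes "distinct [r, s, t]" "{r, s, t} \<subseteq> {0, 1, 2, 3}"
  shows "adj (carrier M) (X r s) (X s t)"
  unfolding adj_def
  using tet_relations(2)[OF assms, where 'k = 'k] lie_module_act[OF tet_irrep_lie_module]
    lie_module_lin[OF tet_irrep_lie_module]
  by (metis (no_types, lifting))

lemma tet_irrep_skew: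
  assumes "distinct [r, s]" "{r, s} \<subseteq> {0, 1, 2, 3}" "v \<in> carrier M"
  shows "X r s v = - X s r v"
proof -
  have "act M (tet_X r s + tet_X s r) v = 0"
    unfolding tet_relations(1)[OF assms(1,2)]
    by (rule lie_module_act_zero[OF tet_irrep_lie_module assms(3)])
  then show ?thesis
    by (simp add: lie_module_act[OF tet_irrep_lie_module assms(3)] eq_neg_iff_add_eq_0)
qed

lemma tet_irrep_dolan_grady:
  assumes "distinct [r, s, t, u]" "{r, s, t, u} \<subseteq> {0, 1, 2, 3}"
  shows "dolan_grady (carrier M) (X r s) (X t u)"
  by (rule lie_module_dolan_grady[OF tet_irrep_lie_module tet_relations(3)[OF assms]])

text \<open>The four paths 0-1-2-3, 0-1-3-2, 1-0-2-3 and 1-0-3-2, with \<open>X 1 0\<close> and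
  \<open>X 3 2\<close> rewritten as negatives, so that every path joins A or -A to B or -B.\<close>

lemma tet_irrep_adj_generators:
  shows "adj (carrier M) (X 0 1) (X 1 2)" "adj (carrier M) (X 1 2) (X 2 3)"
    "adj (carrier M) (X 0 1) (X 1 3)" "adj (carrier M) (X 1 3) (neg (X 2 3))"
    "adj (carrier M) (neg (X 0 1)) (X 0 2)" "adj (carrier M) (X 0 2) (X 2 3)"
    "adj (carrier M) (neg (X 0 1)) (X 0 3)" "adj (carrier M) (X 0 3) (neg (X 2 3))"
proof -
  have neg: "X 1 0 v = - X 0 1 v" "X 3 2 v = - X 2 3 v" if "v \<in> carrier M" for v
    using that by (auto intro!: tet_irrep_skew)
  show "adj (carrier M) (X 0 1) (X 1 2)" "adj (carrier M) (X 1 2) (X 2 3)"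
    "adj (carrier M) (X 0 1) (X 1 3)" "adj (carrier M) (X 0 2) (X 2 3)"
    by (rule tet_irrep_adj; simp)+
  show "adj (carrier M) (X 1 3) (neg (X 2 3))"
    by (rule adj_cong[OF tet_irrep_adj[of 1 3 2]]) (simp_all add: neg del: One_nat_def)
  show "adj (carrier M) (X 0 3) (neg (X 2 3))"
    by (rule adj_cong[OF tet_irrep_adj[of 0 3 2]]) (simp_all add: neg del: One_nat_def)
  show "adj (carrier M) (neg (X 0 1)) (X 0 2)"
    by (rule adj_cong[OF tet_irrep_adj[of 1 0 2]]) (simp_all add: neg del: One_nat_def)
  show "adj (carrier M) (neg (X 0 1)) (X 0 3)"
    by (rule adj_cong[OF tet_irrep_adj[of 1 0 3]]) (simp_all add: neg del: One_nat_def)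
qed

text \<open>
  A minimal nonzero subspace \<open>W\<close> that is invariant under \<open>X\<^sub>0\<^sub>1\<close> and \<open>X\<^sub>2\<^sub>3\<close> has type \<open>(0, 0)\<close> and is
  invariant under the other generators, so it is the whole module.
\<close>

lemma tet_irrep_restriction:
  shows "irr (carrier M) (X 0 1) (X 2 3)"
    and "\<exists>d. eigs (carrier M) (X 0 1) = weights d \<and> eigs (carrier M) (X 2 3) = weights d"
proof -
  note M' = tet_irrep_lie_module
  note lM = lie_module_lin[OF M']
  let ?V = "carrier M" and ?A = "X 0 1" and ?B = "X 2 3"
  have V: "?V \<noteq> {0}" using M by (simp add: fd_irreducible_modules_def irreducible_mod_def)
  obtain C where C: "finite C" "span C = ?V"
    using M unfolding fd_irreducible_modules_def finite_dim_def by blast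
  obtain W where W: "W \<subseteq> ?V" "irr W ?A ?B"
    using ex_irr_subspace[OF C lM lM V] by blast
  note adj = tet_irrep_adj_generators
  have dg_sub: "dolan_grady W F G" if "dolan_grady ?V F G" for F G
    using that W(1) unfolding dolan_grady_def by blast
  have dg: "dolan_grady W ?A ?B" "dolan_grady W ?B ?A"
    using tet_irrep_dolan_grady[of 0 1 2 3] tet_irrep_dolan_grady[of 2 3 0 1] by (simp_all add: dg_sub)
  note lW = irrD(2,3)[OF W(2)]
  note irr_neg' = irr_swap[OF irr_neg[OF irr_swap]]
  have "\<exists>d. eigs W ?A = weights d \<and> eigs W ?B = weights d"
    using adj by (intro subspace_eigs_weights[OF C _ _ _ _ W(2,1) dg]) (auto simp: linked_def)
  then obtain d where d: "eigs W ?A = weights d" "eigs W ?B = weights d" by blast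
  have dneg: "eigs W (neg ?A) = weights d" "eigs W (neg ?B) = weights d"
    unfolding eigs_neg d uminus_weights by simp_all
  note dgn = dolan_grady_neg[OF dg(1) lW] dolan_grady_neg[OF dg(2) lW(2,1)]
  note sub = subspace_invariant_adj[OF C]
  have inv: "X 1 2 w \<in> W" "X 1 3 w \<in> W" "X 0 2 w \<in> W" "X 0 3 w \<in> W" if "w \<in> W" for w
    using that
      sub[OF adj(1,2) W(2,1) dg d]
      sub[OF adj(3,4) irr_neg'[OF W(2)] W(1) dgn(2,4) d(1) dneg(2)]
      sub[OF adj(5,6) irr_neg[OF W(2)] W(1) dgn(1,5) dneg(1) d(2)]
      sub[OF adj(7,8) irr_neg[OF irr_neg'[OF W(2)]] W(1) dgn(3,6) dneg]
    by auto
  have W_sub: "subspace W" by (rule lin_subspaces(1)[OF lW(1)])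
  have "act M x w \<in> W" if "w \<in> W" for x w
  proof (rule tet.invariant_if_generators[OF M' W_sub W(1) _ that])
    fix g w assume w: "w \<in> W"
    obtain r s where rs: "r \<noteq> s" "{r, s} \<subseteq> {0, 1, 2, 3}" "abs_tetrahedron (LGen g) = (tet_X r s :: 'k tetrahedron)"
      by (rule abs_tetrahedron_gen_cases)
    have gens: "X r s w \<in> W" if "(r, s) \<in> {(0, 1), (2, 3), (1, 2), (1, 3), (0, 2), (0, 3)}" for r s
      using that inv[OF w] lin_mem[OF lW(1) w] lin_mem[OF lW(2) w] by auto
    show "act M (abs_tetrahedron (LGen g)) w \<in> W"
    proof (cases "r < s")
      case True
      then show ?thesis using rs gens[of r s] by auto
    next
      case False
      then have "X s r w \<in> W" using rs gens[of s r] by auto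
      then show ?thesis
        using rs tet_irrep_skew[of r s w] w W(1) by (auto simp: subspace_neg[OF W_sub])
    qed
  qed
  then have "W = {0} \<or> W = ?V"
    using M W(1) W_sub by (auto simp: fd_irreducible_modules_def irreducible_mod_def)
  then have "W = ?V" using irrD(1)[OF W(2)] by blast
  then show "irr ?V ?A ?B" "\<exists>d. eigs ?V ?A = weights d \<and> eigs ?V ?B = weights d"
    using W(2) d by auto
qed

end

subsection \<open>Irreducible modules of the Onsager algebra\<close>

lemma onsager_type_iff:
  "onsager_type scale N (0, 0) \<longleftrightarrow> (\<exists>d. eigs (carrier N) (act N onsager_X) = weights d \<and>
     eigs (carrier N) (act N onsager_Y) = weights d)"
  by (simp add: onsager_type_def act_eigenvalues_def eigs_def weights_def)

lemma onsager_irreducible_iff: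
  assumes N: "lie_module onsager_scale onsager_br scale N"
  shows "irreducible_mod scale N \<longleftrightarrow> irr (carrier N) (act N onsager_X) (act N onsager_Y)"
proof -
  have inv: "(\<forall>x. \<forall>w\<in>W. act N x w \<in> W) \<longleftrightarrow>
    (\<forall>w\<in>W. act N onsager_X w \<in> W) \<and> (\<forall>w\<in>W. act N onsager_Y w \<in> W)"
    if W: "subspace W" "W \<subseteq> carrier N" for W
  proof safe
    fix x w
    assume *: "\<forall>w\<in>W. act N onsager_X w \<in> W" "\<forall>w\<in>W. act N onsager_Y w \<in> W" and "w \<in> W"
    have "act N (abs_onsager (LGen g)) w \<in> W" if "w \<in> W" for g w
      unfolding abs_onsager_gen using * that by (cases g) simp_all
    then show "act N x w \<in> W"
      by (rule onsager.invariant_if_generators[OF N W _ \<open>w \<in> W\<close>])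
  qed simp_all
  show ?thesis
    unfolding irreducible_mod_def irr_def
    by (intro conj_cong refl iffI allI impI; elim conjE)
      (simp_all add: lie_module_lin[OF N] inv)
qed

lemma onsager_dolan_grady:
  assumes "lie_module onsager_scale onsager_br scale N"
  shows "dolan_grady (carrier N) (act N onsager_X) (act N onsager_Y)"
    "dolan_grady (carrier N) (act N onsager_Y) (act N onsager_X)"
  by (rule lie_module_dolan_grady[OF assms] onsager_relations)+


text \<open>Of the 24 relations between adjacent generators, the four split decompositions give 8,
  \<open>adj_triangle\<close> gives 4 more, and reversing paths doubles these 12. Of the 24
  relations between opposite generators, 6 are given or come from
  \<open>dolan_grady_opposite\<close>, and signs produce the other 18.\<close>

lemma ex_tetrahedron_operators:
  assumes irr: "irr V A B" and dg: "dolan_grady V A B" "dolan_grady V B A"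
    and e: "eigs V A = weights d" "eigs V B = weights d"
  obtains X where "X 0 1 = A" "X (2 :: nat) (3 :: nat) = B" "\<And>r s. lin V V (X r s)"
    "\<And>r s. r \<noteq> s \<Longrightarrow> X s r = neg (X r s)"
    "\<And>r s t. distinct [r, s, t] \<Longrightarrow> {r, s, t} \<subseteq> {0, 1, 2, 3} \<Longrightarrow> adj V (X r s) (X s t)"
    "\<And>r s t u. distinct [r, s, t, u] \<Longrightarrow> {r, s, t, u} \<subseteq> {0, 1, 2, 3} \<Longrightarrow>
      dolan_grady V (X r s) (X t u)"
proof -
  note A = irrD(2)[OF irr] and B = irrD(3)[OF irr]
  have e': "eigs V (neg A) = weights d" "eigs V (neg B) = weights d"
    unfolding eigs_neg e uminus_weights by simp_all
  note dgn = dolan_grady_neg[OF dg(1) A B] dolan_grady_neg[OF dg(2) B A]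
  note irrs = irr_swap[OF irr] irr_neg[OF irr] irr_swap[OF irr_neg[OF irr_swap[OF irr]]]
    irr_swap[OF irr_neg[OF irr]] irr_swap[OF irr_neg[OF irr_swap[OF irr_neg[OF irr]]]]
  obtain P12 where P12: "adj V A P12" "adj V P12 B"
    using ex_adj_between[OF irr dg e] by blast
  obtain P13 where P13: "adj V A P13" "adj V P13 (neg B)"
    using ex_adj_between[OF irrs(3) dgn(2,4) e(1) e'(2)] by blast
  obtain P02 where P02: "adj V (neg A) P02" "adj V P02 B"
    using ex_adj_between[OF irrs(2) dgn(1,5) e'(1) e(2)] by blast
  obtain P03 where P03: "adj V (neg A) P03" "adj V P03 (neg B)"
    using ex_adj_between[OF irrs(5) dgn(3,6) e'] by blast
  note l = adjD(2)[OF P12(1)] adjD(2)[OF P13(1)] adjD(2)[OF P02(1)] adjD(2)[OF P03(1)]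
  \<comment> \<open>The default \<open>P03\<close> also covers meaningless index pairs, so that
    \<open>X r s\<close> is linear for all \<open>r\<close> and \<open>s\<close>.\<close>
  define Y where "Y r s = (if (r, s) = (0, 1) then A else if (r, s) = (2, 3) then B
    else if (r, s) = (1, 2) then P12 else if (r, s) = (1, 3) then P13
    else if (r, s) = (0, 2) then P02 else P03)" for r s :: nat
  define X where "X r s = (if r < s then Y r s else neg (Y s r))" for r s
  have up: "X 0 1 = A" "X 2 3 = B" "X 1 2 = P12" "X 1 3 = P13" "X 0 2 = P02" "X 0 3 = P03"
    by (simp_all add: X_def Y_def)
  have down: "X 1 0 = neg A" "X 3 2 = neg B" "X 2 1 = neg P12" "X 3 1 = neg P13" "X 2 0 = neg P02"
    "X 3 0 = neg P03"
    by (simp_all add: X_def Y_def)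
  note vals = up down
  have lin: "lin V V (X r s)" for r s
    unfolding X_def Y_def by (simp add: A B l lin_neg)
  have skew: "X s r = neg (X r s)" if "r \<noteq> s" for r s
    using that by (auto simp: X_def)
  have adj1: "adj V (X 0 1) (X 1 2)" "adj V (X 1 2) (X 2 3)" "adj V (X 0 1) (X 1 3)"
    "adj V (X 1 3) (X 3 2)" "adj V (X 1 0) (X 0 2)" "adj V (X 0 2) (X 2 3)" "adj V (X 1 0) (X 0 3)"
    "adj V (X 0 3) (X 3 2)"
    unfolding vals by (fact P12 P13 P02 P03)+
  have adj2: "adj V (X 2 1) (X 1 0)" "adj V (X 3 2) (X 2 1)" "adj V (X 3 1) (X 1 0)"
    "adj V (X 2 3) (X 3 1)" "adj V (X 2 0) (X 0 1)" "adj V (X 3 2) (X 2 0)" "adj V (X 3 0) (X 0 1)"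
    "adj V (X 2 3) (X 3 0)"
    using adj1[THEN adj_neg] unfolding vals by simp_all
  \<comment> \<open>The last two triangles exchange the roles of \<open>A\<close> and
    \<open>B\<close>, using the reversed paths in \<open>adj2\<close>.\<close>
  have adj3: "adj V (X 1 2) (X 2 0)" "adj V (X 1 3) (X 3 0)" "adj V (X 3 0) (X 0 2)"
    "adj V (X 3 1) (X 1 2)"
    using adj_triangle[OF irr e(2) P12 P02] adj_triangle[OF irrs(3) e'(2) P13 P03]
      adj_triangle[OF irrs(1) e(1), of "X 3 0" "X 2 0"]
      adj_triangle[OF irrs(4) e'(1), of "X 3 1" "X 2 1"] adj2
    unfolding vals by simp_all
  have adj4: "adj V (X 0 2) (X 2 1)" "adj V (X 0 3) (X 3 1)" "adj V (X 2 0) (X 0 3)"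
    "adj V (X 2 1) (X 1 3)"
    using adj3[THEN adj_neg] unfolding vals by simp_all
  note adjs = adj1 adj2 adj3 adj4
  have dg1: "dolan_grady V (X 0 1) (X 2 3)" "dolan_grady V (X 2 3) (X 0 1)"
    "dolan_grady V (X 1 2) (X 0 3)" "dolan_grady V (X 0 3) (X 1 2)"
    "dolan_grady V (X 1 3) (X 0 2)" "dolan_grady V (X 0 2) (X 1 3)"
    using dg dolan_grady_opposite[OF irr e(1) P12 P03] dolan_grady_opposite[OF irrs(5) e'(1) P03, of P12]
      dolan_grady_opposite[OF irrs(3) e(1) P13, of P02] dolan_grady_opposite[OF irrs(2) e'(1) P02, of P13]
      P12 P13 P02
    unfolding vals by simp_all
  note dg_neg = dg1[THEN dolan_grady_neg(1)] dg1[THEN dolan_grady_neg(2)] dg1[THEN dolan_grady_neg(3)]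
  have dg2: "dolan_grady V (X 1 0) (X 2 3)" "dolan_grady V (X 3 2) (X 0 1)"
    "dolan_grady V (X 2 1) (X 0 3)" "dolan_grady V (X 3 0) (X 1 2)"
    "dolan_grady V (X 3 1) (X 0 2)" "dolan_grady V (X 2 0) (X 1 3)"
    "dolan_grady V (X 0 1) (X 3 2)" "dolan_grady V (X 2 3) (X 1 0)"
    "dolan_grady V (X 1 2) (X 3 0)" "dolan_grady V (X 0 3) (X 2 1)"
    "dolan_grady V (X 1 3) (X 2 0)" "dolan_grady V (X 0 2) (X 3 1)"
    "dolan_grady V (X 1 0) (X 3 2)" "dolan_grady V (X 3 2) (X 1 0)"
    "dolan_grady V (X 2 1) (X 3 0)" "dolan_grady V (X 3 0) (X 2 1)"
    "dolan_grady V (X 3 1) (X 2 0)" "dolan_grady V (X 2 0) (X 3 1)"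
    using dg_neg[OF lin lin] unfolding vals by simp_all
  have "\<forall>r\<in>{0, 1, 2, 3}. \<forall>s\<in>{0, 1, 2, 3}. \<forall>t\<in>{0, 1, 2, 3}.
      distinct [r, s, t] \<longrightarrow> adj V (X r s) (X s t)"
    by (simp add: adjs del: One_nat_def)
  moreover have "\<forall>r\<in>{0, 1, 2, 3}. \<forall>s\<in>{0, 1, 2, 3}. \<forall>t\<in>{0, 1, 2, 3}. \<forall>u\<in>{0, 1, 2, 3}.
      distinct [r, s, t, u] \<longrightarrow> dolan_grady V (X r s) (X t u)"
    by (simp add: dg1 dg2 del: One_nat_def)
  ultimately show thesis by (intro that[of X] up lin) (rule skew, assumption | simp only: insert_subset)+
qed

subsection \<open>Restriction and extension\<close>

lemma irr_cong:
  assumes "irr V A B" "\<And>v. v \<in> V \<Longrightarrow> A v = A' v" "\<And>v. v \<in> V \<Longrightarrow> B v = B' v"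
  shows "irr V A' B'"
  unfolding irr_def
proof (intro conjI allI impI)
  show "V \<noteq> {0}" "lin V V A'" "lin V V B'"
    using irrD(1-3)[OF assms(1)] lin_cong assms by blast+
  fix W assume "subspace W" "W \<subseteq> V" "\<forall>w\<in>W. A' w \<in> W" "\<forall>w\<in>W. B' w \<in> W"
  then show "W = {0} \<or> W = V"
    using assms(2,3) by (intro irrD(4)[OF assms(1)]) (auto simp: subset_iff)
qed

lemma eigs_cong: "(\<And>v. v \<in> V \<Longrightarrow> A v = A' v) \<Longrightarrow> eigs V A = eigs V A'"
  by (auto simp: eigs_def)

lemma ex_onsager_restriction:
  assumes M: "M \<in> tet_irreps scale"
  shows "\<exists>N. onsager_restriction scale M N"
proof -
  note lM = lie_module_lin[OF tet_irrep_lie_module[OF M]]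
  define \<rho> where "\<rho> g = act M (case g of OX \<Rightarrow> tet_X 0 1 | OY \<Rightarrow> tet_X 2 3)" for g
  have V: "subspace (carrier M)" "lin (carrier M) (carrier M) (\<rho> g)" for g
    unfolding \<rho>_def using lM lin_subspaces by blast+
  have R: "eval \<rho> s v = eval \<rho> t v" if "(s, t) \<in> onsager_rel" "v \<in> carrier M" for s t v
    using that tet_irrep_dolan_grady[OF M, of 0 1 2 3] tet_irrep_dolan_grady[OF M, of 2 3 0 1]
    by (auto simp: onsager_rel_def Let_def \<rho>_def dolan_grady_def)
  let ?N = "onsager.induced_module (carrier M) \<rho>"
  have act: "act ?N (abs_onsager t) v = eval \<rho> t v" if "v \<in> carrier M" for t v
    using that by (intro onsager.act_induced_module V R)
  have lie: "lie_module onsager_scale onsager_br scale ?N"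
    by (intro onsager.lie_module_induced_module V R)
  have "act ?N onsager_X v = act M (tet_X 0 1) v" "act ?N onsager_Y v = act M (tet_X 2 3) v"
    if "v \<in> carrier M" for v
    using act[OF that, of "LGen OX"] act[OF that, of "LGen OY"]
    by (simp_all add: abs_onsager_gen \<rho>_def)
  then show ?thesis
    unfolding onsager_restriction_def
    using lie onsager.carrier_induced_module by blast
qed

lemma onsager_restriction_irrep:
  assumes M: "M \<in> tet_irreps scale" and N: "onsager_restriction scale M N"
  shows "N \<in> onsager_irreps_of_type scale (0, 0)"
proof -
  have N': "lie_module onsager_scale onsager_br scale N" "carrier N = carrier M"
    "v \<in> carrier M \<Longrightarrow> act M (tet_X 0 1) v = act N onsager_X v"
    "v \<in> carrier M \<Longrightarrow> act M (tet_X 2 3) v = act N onsager_Y v" for v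
    using N by (simp_all add: onsager_restriction_def)
  have "irreducible_mod scale N"
    unfolding onsager_irreducible_iff[OF N'(1)] N'(2)
    by (rule irr_cong[OF tet_irrep_restriction(1)[OF M] N'(3,4)])
  moreover have "onsager_type scale N (0, 0)"
    unfolding onsager_type_iff N'(2)
    using tet_irrep_restriction(2)[OF M] eigs_cong[OF N'(3)] eigs_cong[OF N'(4)] by simp
  moreover have "finite_dim scale N"
    using M N'(2) by (simp add: fd_irreducible_modules_def finite_dim_def)
  ultimately show ?thesis
    using N'(1) by (simp add: onsager_irreps_of_type_def fd_irreducible_modules_def)
qed

lemma ex_tetrahedron_extension:
  assumes N: "N \<in> onsager_irreps_of_type scale (0, 0)"
  shows "\<exists>M\<in>tet_irreps scale. onsager_restriction scale M N"
proof -
  let ?V = "carrier N"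
  have N': "lie_module onsager_scale onsager_br scale N" "finite_dim scale N" "irreducible_mod scale N"
    "onsager_type scale N (0, 0)"
    using N by (simp_all add: onsager_irreps_of_type_def fd_irreducible_modules_def)
  note irr = N'(3)[unfolded onsager_irreducible_iff[OF N'(1)]]
  obtain d where "eigs ?V (act N onsager_X) = weights d" "eigs ?V (act N onsager_Y) = weights d"
    using N'(4) unfolding onsager_type_iff by blast
  from ex_tetrahedron_operators[OF irr onsager_dolan_grady[OF N'(1)] this]
  obtain X where X: "X 0 1 = act N onsager_X" "X (2 :: nat) (3 :: nat) = act N onsager_Y"
    "\<And>r s. lin ?V ?V (X r s)" "\<And>r s. r \<noteq> s \<Longrightarrow> X s r = neg (X r s)"
    "\<And>r s t. distinct [r, s, t] \<Longrightarrow> {r, s, t} \<subseteq> {0, 1, 2, 3} \<Longrightarrow> adj ?V (X r s) (X s t)"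
    "\<And>r s t u. distinct [r, s, t, u] \<Longrightarrow> {r, s, t, u} \<subseteq> {0, 1, 2, 3} \<Longrightarrow>
      dolan_grady ?V (X r s) (X t u)" by blast
  define \<rho> where "\<rho> g = (case Rep_tet_gen g of (r, s) \<Rightarrow> X r s)" for g
  have \<rho>: "\<rho> (Abs_tet_gen (r, s)) = X r s" if "r \<noteq> s" "{r, s} \<subseteq> {0, 1, 2, 3}" for r s
    unfolding \<rho>_def using that by (subst Abs_tet_gen_inverse) auto
  have V: "subspace ?V" "lin ?V ?V (\<rho> g)" for g
    using X(3) lin_subspaces unfolding \<rho>_def by (blast, auto split: prod.split)
  have R: "eval \<rho> s v = eval \<rho> t v" if "(s, t) \<in> tet_rel" "v \<in> ?V" for s t v
    using that(1)
  proof cases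
    case (skew r s)
    then show ?thesis using X(4)[of r s] by (simp add: \<rho> insert_commute)
  next
    case (adjacent r s t)
    then show ?thesis using X(5)[of r s t] that(2) by (simp add: \<rho> adj_def)
  next
    case (opposite r s t u)
    then show ?thesis using X(6)[of r s t u] that(2) by (simp add: \<rho> dolan_grady_def)
  qed
  define M where "M = tet.induced_module ?V \<rho>"
  have carrier: "carrier M = ?V" unfolding M_def by (rule tet.carrier_induced_module)
  have lie: "lie_module tet_scale tet_br scale M"
    unfolding M_def by (intro tet.lie_module_induced_module V R)
  have act: "act M (tet_X r s) v = X r s v" if "v \<in> ?V" "r \<noteq> s" "{r, s} \<subseteq> {0, 1, 2, 3}" for r s v
  proof -
    have "act M (abs_tetrahedron (tet_gen_term r s)) v = eval \<rho> (tet_gen_term r s) v"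
      unfolding M_def using that(1) by (intro tet.act_induced_module V R)
    then show ?thesis using \<rho>[OF that(2,3)] by (simp add: tet_X_def)
  qed
  have XY: "act M (tet_X 0 1) v = act N onsager_X v" "act M (tet_X 2 3) v = act N onsager_Y v"
    if "v \<in> ?V" for v
    using act[OF that, of 0 1] act[OF that, of 2 3] X(1,2) by simp_all
  have "W = {0} \<or> W = ?V"
    if W: "subspace W" "W \<subseteq> ?V" "\<forall>x. \<forall>w\<in>W. act M x w \<in> W" for W
    using W XY by (intro irrD(4)[OF irr W(1,2)]) (metis subsetD)+
  then have "irreducible_mod scale M"
    using irrD(1)[OF irr] unfolding irreducible_mod_def carrier by blast
  then have "M \<in> tet_irreps scale"
    using lie N'(2) by (simp add: fd_irreducible_modules_def finite_dim_def carrier)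
  moreover have "onsager_restriction scale M N"
    using N'(1) XY by (simp add: onsager_restriction_def carrier)
  ultimately show ?thesis by blast
qed

subsection \<open>Isomorphisms\<close>

text \<open>The difference \<open>f (P v) - P' (f v)\<close> satisfies the homogeneous relations
  with shifts 2 and -2, so the highest eigenvector of \<open>A\<close> would be sent to the missing
  eigenvalue d + 2. With \<open>f\<close> the identity this is uniqueness of
  \<open>P\<close>.\<close>

lemma intertwiner_adj:
  assumes irr: "irr V A B" and e: "eigs V A = weights d" "eigs V' A' \<subseteq> weights d"
    and P: "adj V A P" "adj V P B" and P': "adj V' A' P'" "adj V' P' B'" and f: "lin V V' f"
    and fA: "\<And>v. v \<in> V \<Longrightarrow> f (A v) = A' (f v)" and fB: "\<And>v. v \<in> V \<Longrightarrow> f (B v) = B' (f v)"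
    and v: "v \<in> V"
  shows "f (P v) = P' (f v)"
proof -
  note lA = adjD(1)[OF P(1)] and lB = adjD(2)[OF P(2)] and lP = adjD(2)[OF P(1)]
  note lA' = adjD(1)[OF P'(1)] and lB' = adjD(2)[OF P'(2)] and lP' = adjD(2)[OF P'(1)]
  define D where "D v = f (P v) - P' (f v)" for v
  have D: "lin V V' D"
    unfolding D_def by (rule lin_sub[OF lin_comp[OF f lP] lin_comp[OF lP' f]])
  note mem = lin_mem[OF f] lin_mem[OF lP] lin_mem[OF lP'] lin_mem[OF lA] lin_mem[OF lB] lin_mem[OF lA']
    lin_mem[OF lB']
  have fP: "f (P (A v)) = f (A (P v)) - 2 \<cdot> f (A v) - 2 \<cdot> f (P v)"
    "f (P (B v)) = f (B (P v)) + 2 \<cdot> f (P v) + 2 \<cdot> f (B v)" if "v \<in> V" for v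
  proof -
    have "P (A v) = A (P v) - 2 \<cdot> A v - 2 \<cdot> P v" using adjD(3)[OF P(1) that] by (simp add: algebra_simps)
    then show "f (P (A v)) = f (A (P v)) - 2 \<cdot> f (A v) - 2 \<cdot> f (P v)"
      using that by (simp add: mem lin_diff[OF f] lin_scale[OF f] subspace_mem[OF lin_subspaces(1)[OF lA]])
    show "f (P (B v)) = f (B (P v)) + 2 \<cdot> f (P v) + 2 \<cdot> f (B v)"
      unfolding adjD(3)[OF P(2) that]
      using that by (simp add: mem lin_add[OF f] lin_scale[OF f] subspace_mem[OF lin_subspaces(1)[OF lA]])
  qed
  have AD: "A' (D v) = D (A v) + 2 \<cdot> D v" if "v \<in> V" for v
    using that adjD(3)[OF P'(1), of "f v"]
    by (simp add: D_def mem fP fA lin_diff[OF lA'] scale_right_diff_distrib)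
  have BD: "B' (D v) = D (B v) + (- 2) \<cdot> D v" if "v \<in> V" for v
    using that adjD(3)[OF P'(2), of "f v"]
    by (simp add: D_def mem fP fB lin_diff[OF lB'] scale_right_diff_distrib)
  obtain t where t: "t \<in> V" "t \<noteq> 0" "A t = of_nat d \<cdot> t"
    using of_nat_mem_weights[of d] unfolding e(1)[symmetric] eigs_def by blast
  have "A' (D t) = (of_nat d + 2 * of_nat 1) \<cdot> D t"
    using AD[OF t(1)] t(3) lin_scale[OF D t(1)] by (simp add: scale_left_distrib)
  moreover have "of_nat d + 2 * of_nat 1 \<notin> eigs V' A'"
    using of_nat_add_even_notin_weights(1)[of 1 d] e(2) by auto
  ultimately have "D t = 0" using lin_mem[OF D t(1)] unfolding eigs_def by blast
  then have "D v = 0"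
    using irr_intertwiner_zero[OF irr D lin_zero[OF lA'] lin_zero[OF lB'] AD BD t(1,2) _ v] by blast
  then show ?thesis by (simp add: D_def)
qed


section \<open>Isomorphism is an equivalence relation, compatible with restriction\<close>

lemma mod_isomorphic_iff:
  assumes "lie_module scaleL br scale M" "lie_module scaleL br scale N"
  shows "mod_isomorphic scale M N \<longleftrightarrow> (\<exists>f. bij_betw f (carrier M) (carrier N) \<and>
    lin (carrier M) (carrier N) f \<and> (\<forall>x. \<forall>v\<in>carrier M. f (act M x v) = act N x (f v)))"
  using lin_subspaces(1)[OF lie_module_lin[OF assms(1)]] lin_subspaces(1)[OF lie_module_lin[OF assms(2)]]
  unfolding mod_isomorphic_def lin_def bij_betw_def by auto

lemma mod_isomorphic_refl: "mod_isomorphic scale M M"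
  unfolding mod_isomorphic_def by (intro exI[of _ id]) simp

lemma mod_isomorphic_trans:
  assumes "mod_isomorphic scale L M" "mod_isomorphic scale M N"
  shows "mod_isomorphic scale L N"
proof -
  obtain f where f: "bij_betw f (carrier L) (carrier M)"
    "\<forall>v\<in>carrier L. \<forall>w\<in>carrier L. f (v + w) = f v + f w"
    "\<forall>c. \<forall>v\<in>carrier L. f (c \<cdot> v) = c \<cdot> f v"
    "\<forall>x. \<forall>v\<in>carrier L. f (act L x v) = act M x (f v)"
    using assms(1) unfolding mod_isomorphic_def by blast
  obtain g where g: "bij_betw g (carrier M) (carrier N)"
    "\<forall>v\<in>carrier M. \<forall>w\<in>carrier M. g (v + w) = g v + g w"
    "\<forall>c. \<forall>v\<in>carrier M. g (c \<cdot> v) = c \<cdot> g v"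
    "\<forall>x. \<forall>v\<in>carrier M. g (act M x v) = act N x (g v)"
    using assms(2) unfolding mod_isomorphic_def by blast
  have "f v \<in> carrier M" if "v \<in> carrier L" for v using bij_betwE[OF f(1)] that by blast
  then show ?thesis
    unfolding mod_isomorphic_def using f g
    by (intro exI[of _ "g \<circ> f"]) (simp add: bij_betw_trans[OF f(1) g(1)])
qed

lemma mod_isomorphic_sym:
  assumes M: "lie_module scaleL br scale M" and iso: "mod_isomorphic scale M N"
  shows "mod_isomorphic scale N M"
proof -
  obtain f where f: "bij_betw f (carrier M) (carrier N)"
    "\<forall>v\<in>carrier M. \<forall>w\<in>carrier M. f (v + w) = f v + f w"
    "\<forall>c. \<forall>v\<in>carrier M. f (c \<cdot> v) = c \<cdot> f v"
    "\<forall>x. \<forall>v\<in>carrier M. f (act M x v) = act N x (f v)"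
    using iso unfolding mod_isomorphic_def by blast
  note lM = lie_module_lin[OF M]
  note s = lin_subspaces(1)[OF lM] 
  define g where "g = inv_into (carrier M) f"
  have g: "bij_betw g (carrier N) (carrier M)" unfolding g_def by (rule bij_betw_inv_into[OF f(1)])
  have gf: "g (f v) = v" if "v \<in> carrier M" for v
    unfolding g_def by (rule bij_betw_inv_into_left[OF f(1) that])
  have ex: "\<exists>v\<in>carrier M. w = f v" if "w \<in> carrier N" for w
    using that f(1) unfolding bij_betw_def by blast
  have "g (v + w) = g v + g w" if vw: "v \<in> carrier N" "w \<in> carrier N" for v w
  proof -
    obtain v' w' where *: "v' \<in> carrier M" "w' \<in> carrier M" "v = f v'" "w = f w'"
      using ex vw by meson
    have "g (v + w) = g (f (v' + w'))" using f(2) * by simp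
    then show ?thesis using * by (simp add: gf subspace_add[OF s])
  qed
  moreover have "g (c \<cdot> v) = c \<cdot> g v" "g (act N x v) = act M x (g v)" if v: "v \<in> carrier N" for c x v
  proof -
    obtain v' where *: "v' \<in> carrier M" "v = f v'" using ex v by blast
    have "g (c \<cdot> v) = g (f (c \<cdot> v'))" "g (act N x v) = g (f (act M x v'))" using f(3,4) * by simp_all
    then show "g (c \<cdot> v) = c \<cdot> g v" "g (act N x v) = act M x (g v)"
      using * by (simp_all add: gf subspace_scale[OF s] lin_mem[OF lM])
  qed
  ultimately show ?thesis unfolding mod_isomorphic_def using g by blast
qed

lemma restriction_isomorphic:
  assumes M: "M \<in> tet_irreps scale" "M' \<in> tet_irreps scale"
    and N: "onsager_restriction scale M N" "onsager_restriction scale M' N'"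
    and iso: "mod_isomorphic scale M M'"
  shows "mod_isomorphic scale N N'"
proof -
  note lie = tet_irrep_lie_module[OF M(1)] tet_irrep_lie_module[OF M(2)]
  have lie': "lie_module onsager_scale onsager_br scale N" "lie_module onsager_scale onsager_br scale N'"
    and c: "carrier N = carrier M" "carrier N' = carrier M'"
    using N by (simp_all add: onsager_restriction_def)
  obtain f where f: "bij_betw f (carrier M) (carrier M')" "lin (carrier M) (carrier M') f"
    "\<And>x v. v \<in> carrier M \<Longrightarrow> f (act M x v) = act M' x (f v)"
    using iso unfolding mod_isomorphic_iff[OF lie] by blast
  have "f (act N x v) = act N' x (f v)" if "v \<in> carrier N" for x v
  proof (rule onsager.intertwiner_if_generators[OF lie' f(2)[folded c] _ that])
    fix g v assume v: "v \<in> carrier N"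
    then have "f v \<in> carrier M'" using lin_mem[OF f(2)] c by simp
    then show "f (act N (abs_onsager (LGen g)) v) = act N' (abs_onsager (LGen g)) (f v)"
      using N v f(3) unfolding abs_onsager_gen by (cases g) (simp_all add: onsager_restriction_def)
  qed
  then show ?thesis
    unfolding mod_isomorphic_iff[OF lie'] using f(1,2) c by auto
qed

lemma isomorphic_if_restriction_isomorphic:
  assumes M: "M \<in> tet_irreps scale" "M' \<in> tet_irreps scale"
    and N: "onsager_restriction scale M N" "onsager_restriction scale M' N'"
    and iso: "mod_isomorphic scale N N'"
  shows "mod_isomorphic scale M M'"
proof -
  note lie = tet_irrep_lie_module[OF M(1)] tet_irrep_lie_module[OF M(2)]
  note irr = tet_irrep_restriction(1)[OF M(1)]
  let ?V = "carrier M" and ?V' = "carrier M'"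
  let ?X = "\<lambda>r s. act M (tet_X r s)" and ?X' = "\<lambda>r s. act M' (tet_X r s)"
  have lie': "lie_module onsager_scale onsager_br scale N" "lie_module onsager_scale onsager_br scale N'"
    and c: "carrier N = ?V" "carrier N' = ?V'"
    and X: "v \<in> ?V \<Longrightarrow> act N onsager_X v = ?X 0 1 v" "v \<in> ?V \<Longrightarrow> act N onsager_Y v = ?X 2 3 v"
    and X': "v \<in> ?V' \<Longrightarrow> act N' onsager_X v = ?X' 0 1 v" "v \<in> ?V' \<Longrightarrow> act N' onsager_Y v = ?X' 2 3 v"
    for v
    using N by (simp_all add: onsager_restriction_def)
  obtain f where f: "bij_betw f ?V ?V'" "lin ?V ?V' f"
    "\<And>x v. v \<in> ?V \<Longrightarrow> f (act N x v) = act N' x (f v)"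
    using iso unfolding mod_isomorphic_iff[OF lie'] c by blast
  have f01: "f (?X 0 1 v) = ?X' 0 1 (f v)" and f23: "f (?X 2 3 v) = ?X' 2 3 (f v)" if "v \<in> ?V" for v
    using f(3)[OF that] X[OF that] X'[OF lin_mem[OF f(2) that]] by metis+
  obtain d where d: "eigs ?V (?X 0 1) = weights d" "eigs ?V (?X 2 3) = weights d"
    using tet_irrep_restriction(2)[OF M(1)] by blast
  \<comment> \<open>\<open>tet_irrep_restriction\<close> for \<open>M'\<close> would yield a
    \<open>d\<close> of its own, so the bound on the spectrum is carried over along the bijection
    \<open>f\<close>.\<close>
  have d': "eigs ?V' (?X' 0 1) \<subseteq> weights d"
  proof
    fix k assume "k \<in> eigs ?V' (?X' 0 1)"
    then obtain w where w: "w \<in> ?V'" "w \<noteq> 0" "?X' 0 1 w = k \<cdot> w" unfolding eigs_def by blast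
    then obtain v where v: "v \<in> ?V" "w = f v" using f(1) unfolding bij_betw_def by blast
    have "f (?X 0 1 v) = f (k \<cdot> v)" using w v by (simp add: f01 lin_scale[OF f(2)] del: One_nat_def)
    then have "?X 0 1 v = k \<cdot> v"
      using f(1) v(1) lin_mem[OF lie_module_lin[OF lie(1)]] subspace_scale[OF lin_subspaces(1)[OF f(2)]]
      unfolding bij_betw_def by (auto dest: inj_onD)
    moreover have "v \<noteq> 0" using v(2) w(2) lin_zero[OF f(2)] by auto
    ultimately have "k \<in> eigs ?V (?X 0 1)" using v(1) by (auto simp: eigs_def)
    then show "k \<in> weights d" using d(1) by simp
  qed
  have dneg: "eigs ?V (neg (?X 0 1)) = weights d" "eigs ?V' (neg (?X' 0 1)) \<subseteq> weights d"
    unfolding eigs_neg d using image_mono[OF d', of uminus] by (simp_all add: uminus_weights)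
  note irrs = irr irr_swap[OF irr_neg[OF irr_swap[OF irr]]] irr_neg[OF irr]
    irr_neg[OF irr_swap[OF irr_neg[OF irr_swap[OF irr]]]]
  note adj = tet_irrep_adj_generators[OF M(1)] and adj' = tet_irrep_adj_generators[OF M(2)]
  have fm: "f v \<in> ?V'" if "v \<in> ?V" for v using lin_mem[OF f(2) that] .
  have fneg: "f (- ?X 0 1 v) = - ?X' 0 1 (f v)" "f (- ?X 2 3 v) = - ?X' 2 3 (f v)" if "v \<in> ?V" for v
    using that by (simp_all add: lin_minus[OF f(2)] lin_mem[OF lie_module_lin[OF lie(1)]] f01 f23 del: One_nat_def)
  have gens: "f (?X r s v) = ?X' r s (f v)"
    if "v \<in> ?V" "(r, s) \<in> {(0, 1), (2, 3), (1, 2), (1, 3), (0, 2), (0, 3)}" for r s v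
    using that(2) f01[OF that(1)] f23[OF that(1)]
      intertwiner_adj[OF irrs(1) d(1) d' adj(1,2) adj'(1,2) f(2) f01 f23 that(1)]
      intertwiner_adj[OF irrs(2) d(1) d' adj(3,4) adj'(3,4) f(2) f01 fneg(2) that(1)]
      intertwiner_adj[OF irrs(3) dneg adj(5,6) adj'(5,6) f(2) fneg(1) f23 that(1)]
      intertwiner_adj[OF irrs(4) dneg adj(7,8) adj'(7,8) f(2) fneg that(1)]
    by auto
  have "f (act M x v) = act M' x (f v)" if "v \<in> ?V" for x v
  proof (rule tet.intertwiner_if_generators[OF lie f(2) _ that])
    fix g v assume v: "v \<in> ?V"
    obtain r s where rs: "r \<noteq> s" "{r, s} \<subseteq> {0, 1, 2, 3}"
      "abs_tetrahedron (LGen g) = (tet_X r s :: 'k tetrahedron)"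
      by (rule abs_tetrahedron_gen_cases)
    show "f (act M (abs_tetrahedron (LGen g)) v) = act M' (abs_tetrahedron (LGen g)) (f v)"
    proof (cases "r < s")
      case True
      then show ?thesis using rs gens[OF v, of r s] by auto
    next
      case False
      then have "f (?X s r v) = ?X' s r (f v)" using rs gens[OF v, of s r] by auto
      moreover have "?X r s v = - ?X s r v" "?X' r s (f v) = - ?X' s r (f v)"
        using rs v fm[OF v] by (auto intro!: tet_irrep_skew M)
      ultimately show ?thesis
        using v by (simp add: rs(3) lin_minus[OF f(2)] lin_mem[OF lie_module_lin[OF lie(1)]])
    qed
  qed
  then show ?thesis
    unfolding mod_isomorphic_iff[OF lie] using f(1,2) by blast
qed

section \<open>The bijection between isomorphism classes\<close>

lemma iso_class_eq_iff:
  assumes S: "S \<subseteq> fd_irreducible_modules scaleL br scale" and "M \<in> S" "N \<in> S"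
  shows "iso_class scale S M = iso_class scale S N \<longleftrightarrow> mod_isomorphic scale M N"
proof
  assume "iso_class scale S M = iso_class scale S N"
  then show "mod_isomorphic scale M N"
    using mod_isomorphic_refl \<open>N \<in> S\<close> unfolding iso_class_def by blast
next
  assume iso: "mod_isomorphic scale M N"
  have "lie_module scaleL br scale M" using S \<open>M \<in> S\<close> by (auto simp: fd_irreducible_modules_def)
  with iso show "iso_class scale S M = iso_class scale S N"
    unfolding iso_class_def using mod_isomorphic_trans mod_isomorphic_sym by blast
qed

end

theorem mainTheorem3:
  fixes scale :: "'k::{alg_closed_field, field_char_0} \<Rightarrow> 'v::ab_group_add \<Rightarrow> 'v"
  assumes "vector_space scale"
  shows "\<exists>\<Phi>. bij_betw \<Phi>
            (iso_classes scale (onsager_irreps_of_type scale (0, 0)))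
            (iso_classes scale (tet_irreps scale)) \<and>
          (\<forall>V \<in> tet_irreps scale.
             (\<exists>W. onsager_restriction scale V W) \<and>
             (\<forall>W. onsager_restriction scale V W \<longrightarrow>
                W \<in> onsager_irreps_of_type scale (0, 0) \<and>
                \<Phi> (iso_class scale (onsager_irreps_of_type scale (0, 0)) W) =
                  iso_class scale (tet_irreps scale) V))"
proof -
  interpret alg_closed_space scale using assms by (simp add: alg_closed_space_def)
  let ?S = "onsager_irreps_of_type scale (0, 0)" and ?T = "tet_irreps scale"
  have S: "?S \<subseteq> fd_irreducible_modules onsager_scale onsager_br scale"
    by (auto simp: onsager_irreps_of_type_def)
  \<comment> \<open>A restriction is pinned down on the carrier only, so
    \<open>onsager_restriction\<close> is a relation, and \<Phi> chooses a \<open>V\<close> that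
    restricts to some member of the class. By \<open>isomorphic_if_restriction_isomorphic\<close>
    the class of \<open>V\<close> does not depend on the choice.\<close>
  define \<Phi> where "\<Phi> c = iso_class scale ?T (SOME V. V \<in> ?T \<and> (\<exists>W\<in>c. onsager_restriction scale V W))" for c
  have \<Phi>: "\<Phi> (iso_class scale ?S W) = iso_class scale ?T V"
    if V: "V \<in> ?T" and W: "onsager_restriction scale V W" for V W
  proof -
    let ?P = "\<lambda>V'. V' \<in> ?T \<and> (\<exists>W'\<in>iso_class scale ?S W. onsager_restriction scale V' W')"
    have "W \<in> iso_class scale ?S W"
      using onsager_restriction_irrep[OF V W] mod_isomorphic_refl by (simp add: iso_class_def)
    then have "?P V" using V W by blast
    then have "?P (Eps ?P)" by (rule someI)
    then obtain W' where *: "Eps ?P \<in> ?T" "mod_isomorphic scale W W'" "onsager_restriction scale (Eps ?P) W'"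
      by (auto simp: iso_class_def)
    then have "mod_isomorphic scale V (Eps ?P)"
      using isomorphic_if_restriction_isomorphic V W by blast
    then show ?thesis
      unfolding \<Phi>_def using iso_class_eq_iff[OF order.refl V *(1)] by simp
  qed
  have "bij_betw \<Phi> (iso_classes scale ?S) (iso_classes scale ?T)"
  proof (rule bij_betwI')
    fix c c' assume "c \<in> iso_classes scale ?S" "c' \<in> iso_classes scale ?S"
    then obtain W W' where W: "W \<in> ?S" "c = iso_class scale ?S W" "W' \<in> ?S" "c' = iso_class scale ?S W'"
      unfolding iso_classes_def by blast
    obtain V V' where V: "V \<in> ?T" "onsager_restriction scale V W" "V' \<in> ?T" "onsager_restriction scale V' W'"
      using ex_tetrahedron_extension W by meson
    have "\<Phi> c = \<Phi> c' \<longleftrightarrow> mod_isomorphic scale V V'"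
      unfolding W \<Phi>[OF V(1,2)] \<Phi>[OF V(3,4)] by (rule iso_class_eq_iff[OF order.refl V(1,3)])
    also have "\<dots> \<longleftrightarrow> mod_isomorphic scale W W'"
      using restriction_isomorphic isomorphic_if_restriction_isomorphic V by blast
    also have "\<dots> \<longleftrightarrow> c = c'"
      unfolding W by (rule iso_class_eq_iff[OF S W(1,3), symmetric])
    finally show "\<Phi> c = \<Phi> c' \<longleftrightarrow> c = c'" .
  next
    fix c assume "c \<in> iso_classes scale ?S"
    then obtain W where "W \<in> ?S" "c = iso_class scale ?S W" unfolding iso_classes_def by blast
    then show "\<Phi> c \<in> iso_classes scale ?T"
      using ex_tetrahedron_extension \<Phi> unfolding iso_classes_def by blast
  next
    fix c assume "c \<in> iso_classes scale ?T"
    then obtain V where V: "V \<in> ?T" "c = iso_class scale ?T V" unfolding iso_classes_def by blast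
    then obtain W where W: "onsager_restriction scale V W" using ex_onsager_restriction by blast
    then show "\<exists>x\<in>iso_classes scale ?S. c = \<Phi> x"
      using \<Phi>[OF V(1) W] V onsager_restriction_irrep[OF V(1) W] unfolding iso_classes_def by blast
  qed
  then show ?thesis
    using ex_onsager_restriction onsager_restriction_irrep \<Phi> by blast
qed

end
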